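(* Let $(\mathbb{W}\times\mathbb{Y},\mathbb{A},P,c)$ be a Markov decision process with incomplete information (MDPII) and let $(\mathbb{P}(\mathbb{W})\times\mathbb{Y},\mathbb{A},q,\bar c)$ be its corresponding belief-MDP (MDPCI). Then the transition kernel $q$ on $\mathbb{P}(\mathbb{W})\times\mathbb{Y}$ given $\mathbb{P}(\mathbb{W})\times\mathbb{Y}\times\mathbb{A}$ is semi-uniform Feller if and only if the transition kernel $P$ on $\mathbb{W}\times\mathbb{Y}$ given $\mathbb{W}\times\mathbb{Y}\times\mathbb{A}$ is semi-uniform Feller.
   Context: For a metric space $\mathbb{S}$, $\mathcal{B}(\mathbb{S})$ is its Borel $\sigma$-field and $\mathbb{P}(\mathbb{S})$ is the set of probability measures on $(\mathbb{S},\mathcal{B}(\mathbb{S}))$, endowed with the topology of weak convergence. A stochastic kernel $\Psi(ds_1|s_2)$ on $\mathbb{S}_1$ given $\mathbb{S}_2$ is a map $\mathcal{B}(\mathbb{S}_1)\times\mathbb{S}_2\to[0,1]$ such that $\Psi(\cdot|s_2)$ is a probability measure for each $s_2$ and $\Psi(B|\cdot)$ is Borel measurable for each $B\in\mathcal{B}(\mathbb{S}_1)$. It is weakly continuous if $s^{(n)}\to s$ implies that $\Psi(\cdot|s^{(n)})$ converges weakly to $\Psi(\cdot|s)$. Semi-uniform Feller: let $\mathbb{S}_1,\mathbb{S}_2,\mathbb{S}_3$ be Borel subsets of Polish spaces. For a stochastic kernel $\Psi$ on $\mathbb{S}_1\times\mathbb{S}_2$ given $\mathbb{S}_3$ write $\Psi(A,B|s_3):=\Psi(A\times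 B|s_3)$. The kernel $\Psi$ is semi-uniform Feller if, whenever $s_3^{(n)}\to s_3$ in $\mathbb{S}_3$, for each bounded continuous function $f$ on $\mathbb{S}_1$, $$\lim_{n\to\infty}\sup_{B\in\mathcal{B}(\mathbb{S}_2)}\left|\int_{\mathbb{S}_1}f(s_1)\Psi(ds_1,B|s_3^{(n)})-\int_{\mathbb{S}_1}f(s_1)\Psi(ds_1,B|s_3)\right|=0.$$ For $P$ this is used with $\mathbb{S}_1=\mathbb{W}$, $\mathbb{S}_2=\mathbb{Y}$, $\mathbb{S}_3=\mathbb{W}\times\mathbb{Y}\times\mathbb{A}$; for $q$ with $\mathbb{S}_1=\mathbb{P}(\mathbb{W})$, $\mathbb{S}_2=\mathbb{Y}$, $\mathbb{S}_3=\mathbb{P}(\mathbb{W})\times\mathbb{Y}\times\mathbb{A}$. MDPII: a tuple $(\mathbb{W}\times\mathbb{Y},\mathbb{A},P,c)$ where $\mathbb{W},\mathbb{Y},\mathbb{A}$ are Borel subsets of Polish spaces ($\mathbb{W}$: unobservable state components, $\mathbb{Y}$: observable state components, $\mathbb{A}$: actions), $P$ is a weakly continuous stochastic kernel on $\mathbb{W}\times\mathbb{Y}$ given $\mathbb{W}\times\mathbb{Y}\times\mathbb{A}$, and $c:\mathbb{W}\times\mathbb{Y}\times\mathbb{A}\to[0,+\infty]$ is a one-step cost function. Belief-MDP (MDPCI): for $B\in\mathcal{B}(\mathbb{W})$, $C\in\mathcal{B}(\mathbb{Y})$, $(z,y,a)\in\mathbb{P}(\mathbb{W})\times\mathbb{Y}\times\mathbb{A}$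 put $R(B\times C|z,y,a):=\int_{\mathbb{W}}P(B\times C|w,y,a)\,z(dw)$. There is a stochastic kernel $H(\cdot|z,y,a,y')$ on $\mathbb{W}$ given $\mathbb{P}(\mathbb{W})\times\mathbb{Y}\times\mathbb{A}\times\mathbb{Y}$ with $R(B\times C|z,y,a)=\int_C H(B|z,y,a,y')R(\mathbb{W},dy'|z,y,a)$; write $H(z,y,a,y')\in\mathbb{P}(\mathbb{W})$ for the measure $H(\cdot|z,y,a,y')$. The MDPCI has state space $\mathbb{P}(\mathbb{W})\times\mathbb{Y}$, action space $\mathbb{A}$, transition kernel $$q(D\times C|z,y,a):=\int_C \mathbf{1}\{H(z,y,a,y')\in D\}\,R(\mathbb{W},dy'|z,y,a),\quad D\in\mathcal{B}(\mathbb{P}(\mathbb{W})),\ C\in\mathcal{B}(\mathbb{Y}),$$ and cost $\bar c(z,y,a):=\int_{\mathbb{W}}c(w,y,a)z(dw)$. The definition of $q$ does not depend on the choice of $H$. *)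

theory Defs
  imports "HOL-Probability.Probability"
begin

text \<open>Spaces are represented by topologies, since the state space of the belief-MDP is a set of
  measures and not a type.  A Borel subset \<open>S\<close> of a Polish space (a type of class
  \<^class>\<open>polish_space\<close>) enters as \<open>top_of_set S\<close>.\<close>

definition borel_of :: "'a topology \<Rightarrow> 'a measure" where
  "borel_of X = sigma (topspace X) {U. openin X U}"

definition prob_measures :: "'a topology \<Rightarrow> 'a measure set" where
  "prob_measures X = {\<mu>. prob_space \<mu> \<and> sets \<mu> = sets (borel_of X)}"

definition bounded_cont :: "'a topology \<Rightarrow> ('a \<Rightarrow> real) set" where
  "bounded_cont X = {f. continuous_map X euclideanreal f \<and> bounded (f ` topspace X)}"

text \<open>The coarsest topology for which \<open>\<mu> \<mapsto> \<integral>f d\<mu>\<close> is continuous for all bounded continuous \<open>f\<close>.\<close>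

definition weak_topology :: "'a topology \<Rightarrow> 'a measure topology" where
  "weak_topology X = topology_generated_by
     {{\<mu> \<in> prob_measures X. (\<integral>x. f x \<partial>\<mu>) \<in> U} | f U. f \<in> bounded_cont X \<and> open U}"

text \<open>Stochastic kernels on \<open>X\<close> given \<open>Y\<close>; the value \<open>K s B\<close> of the literature is
  \<open>emeasure (K s) B\<close>.\<close>

definition stochastic_kernel :: "'a topology \<Rightarrow> 's topology \<Rightarrow> ('s \<Rightarrow> 'a measure) \<Rightarrow> bool" where
  "stochastic_kernel X Y K \<longleftrightarrow>
     (\<forall>s \<in> topspace Y. K s \<in> prob_measures X) \<and>
     (\<forall>B \<in> sets (borel_of X). (\<lambda>s. emeasure (K s) B) \<in> borel_measurable (borel_of Y))"

definition weakly_continuous_kernel ::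
    "'a topology \<Rightarrow> 's topology \<Rightarrow> ('s \<Rightarrow> 'a measure) \<Rightarrow> bool" where
  "weakly_continuous_kernel X Y K \<longleftrightarrow>
     (\<forall>\<sigma> s. limitin Y \<sigma> s sequentially \<longrightarrow>
        limitin (weak_topology X) (\<lambda>n. K (\<sigma> n)) (K s) sequentially)"

text \<open>For a measure \<open>\<mu>\<close> on \<open>X1 \<times> X2\<close>, the measures \<open>\<mu>(\<cdot> \<times> B)\<close> on \<open>X1\<close> and
  \<open>\<mu>(X1 \<times> \<cdot>)\<close> on \<open>X2\<close>.\<close>

definition fst_slice :: "'a topology \<Rightarrow> ('a \<times> 'b) measure \<Rightarrow> 'b set \<Rightarrow> 'a measure" where
  "fst_slice X1 \<mu> B =
     measure_of (topspace X1) (sets (borel_of X1)) (\<lambda>A. emeasure \<mu> (A \<times> B))"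

definition snd_marginal ::
    "'a topology \<Rightarrow> 'b topology \<Rightarrow> ('a \<times> 'b) measure \<Rightarrow> 'b measure" where
  "snd_marginal X1 X2 \<mu> =
     measure_of (topspace X2) (sets (borel_of X2)) (\<lambda>C. emeasure \<mu> (topspace X1 \<times> C))"

definition semi_uniform_Feller ::
    "'a topology \<Rightarrow> 'b topology \<Rightarrow> 's topology \<Rightarrow> ('s \<Rightarrow> ('a \<times> 'b) measure) \<Rightarrow> bool" where
  "semi_uniform_Feller X1 X2 X3 K \<longleftrightarrow>
     (\<forall>\<sigma> s. limitin X3 \<sigma> s sequentially \<longrightarrow>
       (\<forall>f \<in> bounded_cont X1.
         (\<lambda>n. SUP B \<in> sets (borel_of X2).
            \<bar>(\<integral>x. f x \<partial>(fst_slice X1 (K (\<sigma> n)) B)) - (\<integral>x. f x \<partial>(fst_slice X1 (K s) B))\<bar>)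
         \<longlonglongrightarrow> 0))"

text \<open>The kernel \<open>P\<close> takes its argument as \<open>(w, y, a)\<close>.  Nonnegativity of the cost \<open>c\<close> is part of
  its type, and nothing else is required of it.\<close>

definition MDPII ::
    "'w::polish_space set \<Rightarrow> 'y::polish_space set \<Rightarrow> 'a::polish_space set \<Rightarrow>
     ('w \<times> 'y \<times> 'a \<Rightarrow> ('w \<times> 'y) measure) \<Rightarrow> ('w \<times> 'y \<times> 'a \<Rightarrow> ennreal) \<Rightarrow> bool" where
  "MDPII W Y A P c \<longleftrightarrow>
     W \<in> sets borel \<and> Y \<in> sets borel \<and> A \<in> sets borel \<and>
     stochastic_kernel (prod_topology (top_of_set W) (top_of_set Y))
       (prod_topology (top_of_set W) (prod_topology (top_of_set Y) (top_of_set A))) P \<and>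
     weakly_continuous_kernel (prod_topology (top_of_set W) (top_of_set Y))
       (prod_topology (top_of_set W) (prod_topology (top_of_set Y) (top_of_set A))) P"

text \<open>\<open>R(E | z, y, a) = \<integral> P(E | w, y, a) z(dw)\<close>.\<close>

definition joint_kernel ::
    "('w \<times> 'y \<times> 'a \<Rightarrow> ('w \<times> 'y) measure) \<Rightarrow> 'w measure \<times> 'y \<times> 'a \<Rightarrow> ('w \<times> 'y) measure" where
  "joint_kernel P = (\<lambda>(z, y, a). z \<bind> (\<lambda>w. P (w, y, a)))"

definition filter_kernel ::
    "'w::polish_space set \<Rightarrow> 'y::polish_space set \<Rightarrow> 'a::polish_space set \<Rightarrow>
     ('w \<times> 'y \<times> 'a \<Rightarrow> ('w \<times> 'y) measure) \<Rightarrow>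
     ('w measure \<times> 'y \<times> 'a \<times> 'y \<Rightarrow> 'w measure) \<Rightarrow> bool" where
  "filter_kernel W Y A P H \<longleftrightarrow>
     stochastic_kernel (top_of_set W)
       (prod_topology (weak_topology (top_of_set W))
         (prod_topology (top_of_set Y) (prod_topology (top_of_set A) (top_of_set Y)))) H \<and>
     (\<forall>z \<in> prob_measures (top_of_set W). \<forall>y \<in> Y. \<forall>a \<in> A.
       \<forall>B \<in> sets (borel_of (top_of_set W)). \<forall>C \<in> sets (borel_of (top_of_set Y)).
         emeasure (joint_kernel P (z, y, a)) (B \<times> C) =
         (\<integral>\<^sup>+y'\<in>C. emeasure (H (z, y, a, y')) B
            \<partial>(snd_marginal (top_of_set W) (top_of_set Y) (joint_kernel P (z, y, a)))))"

text \<open>\<open>(P(W) \<times> Y, A, q, cbar)\<close> is the belief-MDP of \<open>(W \<times> Y, A, P, c)\<close>.  The choice of the filter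
  kernel \<open>H\<close> does not affect \<open>q\<close>.\<close>

definition MDPCI ::
    "'w::polish_space set \<Rightarrow> 'y::polish_space set \<Rightarrow> 'a::polish_space set \<Rightarrow>
     ('w \<times> 'y \<times> 'a \<Rightarrow> ('w \<times> 'y) measure) \<Rightarrow> ('w \<times> 'y \<times> 'a \<Rightarrow> ennreal) \<Rightarrow>
     ('w measure \<times> 'y \<times> 'a \<Rightarrow> ('w measure \<times> 'y) measure) \<Rightarrow>
     ('w measure \<times> 'y \<times> 'a \<Rightarrow> ennreal) \<Rightarrow> bool" where
  "MDPCI W Y A P c q cbar \<longleftrightarrow>
     stochastic_kernel (prod_topology (weak_topology (top_of_set W)) (top_of_set Y))
       (prod_topology (weak_topology (top_of_set W))
         (prod_topology (top_of_set Y) (top_of_set A))) q \<and>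
     (\<exists>H. filter_kernel W Y A P H \<and>
       (\<forall>z \<in> prob_measures (top_of_set W). \<forall>y \<in> Y. \<forall>a \<in> A.
         \<forall>D \<in> sets (borel_of (weak_topology (top_of_set W))).
         \<forall>C \<in> sets (borel_of (top_of_set Y)).
           emeasure (q (z, y, a)) (D \<times> C) =
           (\<integral>\<^sup>+y'\<in>C. indicator D (H (z, y, a, y'))
              \<partial>(snd_marginal (top_of_set W) (top_of_set Y) (joint_kernel P (z, y, a)))))) \<and>
     (\<forall>z \<in> prob_measures (top_of_set W). \<forall>y \<in> Y. \<forall>a \<in> A.
       cbar (z, y, a) = (\<integral>\<^sup>+w. c (w, y, a) \<partial>z))"


subsection \<open>Basic facts about these notions\<close>

lemma space_borel_of [simp]: "space (borel_of X) = topspace X"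
  unfolding borel_of_def by (rule space_measure_of) (auto dest: openin_subset)

lemma sets_borel_of: "sets (borel_of X) = sigma_sets (topspace X) {U. openin X U}"
  unfolding borel_of_def by (rule sets_measure_of) (auto dest: openin_subset)

lemma sets_borel_of_top_of_set:
  fixes S :: "'a::topological_space set"
  shows "sets (borel_of (top_of_set S)) = sets (restrict_space borel S)"
proof -
  have "sets (restrict_space borel S) = {(\<lambda>x. x) -` A \<inter> S | A. A \<in> sigma_sets UNIV {U. open U}}"
    by (auto simp: sets_restrict_space borel_def)
  also have "\<dots> = sigma_sets S {(\<lambda>x. x) -` A \<inter> S | A. A \<in> {U. open U}}"
    by (rule sigma_sets_vimage_commute) simp
  also have "{(\<lambda>x. x) -` A \<inter> S | A. A \<in> {U. open U}} = {U. openin (top_of_set S) U}"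
    by (auto simp: openin_open)
  finally show ?thesis
    by (simp add: sets_borel_of)
qed

lemma borel_of_measurable_continuous:
  assumes "continuous_map X Y f"
  shows "f \<in> borel_of X \<rightarrow>\<^sub>M borel_of Y"
proof (unfold borel_of_def[of Y], rule measurable_measure_of)
  show "{U. openin Y U} \<subseteq> Pow (topspace Y)"
    by (auto dest: openin_subset)
  show "f \<in> space (borel_of X) \<rightarrow> topspace Y"
    using assms by (simp add: continuous_map_def)
  fix U assume "U \<in> {U. openin Y U}"
  then have "openin X {x \<in> topspace X. f x \<in> U}"
    using assms by (simp add: continuous_map_def)
  moreover have "f -` U \<inter> space (borel_of X) = {x \<in> topspace X. f x \<in> U}"
    by auto
  ultimately show "f -` U \<inter> space (borel_of X) \<in> sets (borel_of X)"
    by (simp add: sets_borel_of sigma_sets.Basic)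
qed

lemma stochastic_kernel_iff:
  "stochastic_kernel X Y K \<longleftrightarrow> K \<in> borel_of Y \<rightarrow>\<^sub>M prob_algebra (borel_of X)"
proof
  assume *: "stochastic_kernel X Y K"
  show "K \<in> borel_of Y \<rightarrow>\<^sub>M prob_algebra (borel_of X)"
    unfolding prob_algebra_def
    using * by (intro measurable_restrict_space2 measurable_subprob_algebra)
       (auto simp: stochastic_kernel_def prob_measures_def intro: prob_space_imp_subprob_space)
next
  assume *: "K \<in> borel_of Y \<rightarrow>\<^sub>M prob_algebra (borel_of X)"
  have "K s \<in> prob_measures X" if "s \<in> topspace Y" for s
    using measurable_space[OF *, of s] that by (simp add: space_prob_algebra prob_measures_def)
  then show "stochastic_kernel X Y K"
    using measurable_emeasure_kernel[OF measurable_prob_algebraD[OF *]]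
    by (simp add: stochastic_kernel_def)
qed

lemma times_in_borel_of_prod:
  assumes "A \<in> sets (borel_of X)" "B \<in> sets (borel_of Y)"
  shows "A \<times> B \<in> sets (borel_of (prod_topology X Y))"
proof -
  have "fst \<in> borel_of (prod_topology X Y) \<rightarrow>\<^sub>M borel_of X"
    "snd \<in> borel_of (prod_topology X Y) \<rightarrow>\<^sub>M borel_of Y"
    by (auto intro: borel_of_measurable_continuous continuous_map_fst continuous_map_snd)
  then have "(fst -` A \<inter> space (borel_of (prod_topology X Y))) \<inter>
      (snd -` B \<inter> space (borel_of (prod_topology X Y))) \<in> sets (borel_of (prod_topology X Y))"
    using assms by (intro sets.Int measurable_sets)
  also have "(fst -` A \<inter> space (borel_of (prod_topology X Y))) \<inter>
      (snd -` B \<inter> space (borel_of (prod_topology X Y))) = A \<times> B"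
    using sets.sets_into_space[OF assms(1)] sets.sets_into_space[OF assms(2)] by auto
  finally show ?thesis .
qed

lemma sets_fst_slice [simp]: "sets (fst_slice X1 \<mu> B) = sets (borel_of X1)"
  unfolding fst_slice_def using sets.sigma_sets_eq[of "borel_of X1"] sets.space_closed[of "borel_of X1"]
  by (simp add: sets_measure_of)

lemma sets_snd_marginal [simp]: "sets (snd_marginal X1 X2 \<mu>) = sets (borel_of X2)"
  unfolding snd_marginal_def using sets.sigma_sets_eq[of "borel_of X2"] sets.space_closed[of "borel_of X2"]
  by (simp add: sets_measure_of)

lemma emeasure_fst_slice:
  assumes \<mu>: "sets \<mu> = sets (borel_of (prod_topology X1 X2))"
    and B: "B \<in> sets (borel_of X2)" and A: "A \<in> sets (borel_of X1)"
  shows "emeasure (fst_slice X1 \<mu> B) A = emeasure \<mu> (A \<times> B)"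
proof (rule emeasure_measure_of[OF fst_slice_def[of X1 \<mu> B]])
  show "sets (borel_of X1) \<subseteq> Pow (topspace X1)"
    using sets.space_closed[of "borel_of X1"] by simp
  show "A \<in> sets (fst_slice X1 \<mu> B)" using A by simp
  show "positive (sets (fst_slice X1 \<mu> B)) (\<lambda>A. emeasure \<mu> (A \<times> B))"
    by (simp add: positive_def)
  show "countably_additive (sets (fst_slice X1 \<mu> B)) (\<lambda>A. emeasure \<mu> (A \<times> B))"
  proof (rule countably_additiveI)
    fix F :: "nat \<Rightarrow> _" assume F: "range F \<subseteq> sets (fst_slice X1 \<mu> B)" "disjoint_family F"
    have "(\<Sum>i. emeasure \<mu> (F i \<times> B)) = emeasure \<mu> (\<Union>i. F i \<times> B)"
      using F B \<mu> times_in_borel_of_prod[of _ X1 B X2]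
      by (intro suminf_emeasure) (auto simp: disjoint_family_on_def)
    also have "(\<Union>i. F i \<times> B) = (\<Union>i. F i) \<times> B" by auto
    finally show "(\<Sum>i. emeasure \<mu> (F i \<times> B)) = emeasure \<mu> ((\<Union>i. F i) \<times> B)" .
  qed
qed

lemma emeasure_snd_marginal:
  assumes \<mu>: "sets \<mu> = sets (borel_of (prod_topology X1 X2))" and C: "C \<in> sets (borel_of X2)"
  shows "emeasure (snd_marginal X1 X2 \<mu>) C = emeasure \<mu> (topspace X1 \<times> C)"
proof (rule emeasure_measure_of[OF snd_marginal_def[of X1 X2 \<mu>]])
  show "sets (borel_of X2) \<subseteq> Pow (topspace X2)"
    using sets.space_closed[of "borel_of X2"] by simp
  show "C \<in> sets (snd_marginal X1 X2 \<mu>)" using C by simp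
  show "positive (sets (snd_marginal X1 X2 \<mu>)) (\<lambda>C. emeasure \<mu> (topspace X1 \<times> C))"
    by (simp add: positive_def)
  show "countably_additive (sets (snd_marginal X1 X2 \<mu>)) (\<lambda>C. emeasure \<mu> (topspace X1 \<times> C))"
  proof (rule countably_additiveI)
    fix F :: "nat \<Rightarrow> _" assume F: "range F \<subseteq> sets (snd_marginal X1 X2 \<mu>)" "disjoint_family F"
    have "topspace X1 \<in> sets (borel_of X1)"
      using sets.top[of "borel_of X1"] by simp
    then have "(\<Sum>i. emeasure \<mu> (topspace X1 \<times> F i)) = emeasure \<mu> (\<Union>i. topspace X1 \<times> F i)"
      using F \<mu> times_in_borel_of_prod[of "topspace X1" X1 _ X2]
      by (intro suminf_emeasure) (auto simp: disjoint_family_on_def)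
    also have "(\<Union>i. topspace X1 \<times> F i) = topspace X1 \<times> (\<Union>i. F i)" by auto
    finally show "(\<Sum>i. emeasure \<mu> (topspace X1 \<times> F i)) = emeasure \<mu> (topspace X1 \<times> (\<Union>i. F i))" .
  qed
qed

lemma emeasure_joint_kernel:
  assumes P: "stochastic_kernel (prod_topology XW XY) (prod_topology XW (prod_topology XY XA)) P"
    and z: "z \<in> prob_measures XW" and ya: "y \<in> topspace XY" "a \<in> topspace XA"
    and E: "E \<in> sets (borel_of (prod_topology XW XY))"
  shows "emeasure (joint_kernel P (z, y, a)) E = (\<integral>\<^sup>+w. emeasure (P (w, y, a)) E \<partial>z)"
proof -
  have sets_z: "sets z = sets (borel_of XW)" and "prob_space z"
    using z by (auto simp: prob_measures_def)
  then have ne: "space z \<noteq> {}" by (simp add: prob_space.not_empty)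
  have "(\<lambda>w. (w, y, a)) \<in> borel_of XW \<rightarrow>\<^sub>M borel_of (prod_topology XW (prod_topology XY XA))"
    using ya by (intro borel_of_measurable_continuous) (simp add: continuous_map_pairedI)
  from measurable_compose[OF this measurable_prob_algebraD[OF P[unfolded stochastic_kernel_iff]]]
  have "(\<lambda>w. P (w, y, a)) \<in> z \<rightarrow>\<^sub>M subprob_algebra (borel_of (prod_topology XW XY))"
    by (simp add: measurable_cong_sets[OF sets_z refl])
  from emeasure_bind[OF ne this E] show ?thesis
    by (simp add: joint_kernel_def)
qed

lemma topspace_weak_topology [simp]: "topspace (weak_topology X) = prob_measures X"
proof -
  have "prob_measures X =
      {\<mu> \<in> prob_measures X. (\<integral>x. (\<lambda>_. 0) x \<partial>\<mu>) \<in> (UNIV :: real set)}" by simp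
  moreover have "(\<lambda>_. 0) \<in> bounded_cont X"
    by (auto simp: bounded_cont_def bounded_iff)
  ultimately have "prob_measures X \<in>
      {{\<mu> \<in> prob_measures X. (\<integral>x. f x \<partial>\<mu>) \<in> U} | f U. f \<in> bounded_cont X \<and> open U}"
    using open_UNIV by blast
  then show ?thesis
    unfolding weak_topology_def topology_generated_by_topspace by blast
qed

lemma limitin_weak_topology:
  "limitin (weak_topology X) \<mu>s \<mu> F \<longleftrightarrow>
     \<mu> \<in> prob_measures X \<and> (\<forall>\<^sub>F i in F. \<mu>s i \<in> prob_measures X) \<and>
     (\<forall>f \<in> bounded_cont X. ((\<lambda>i. \<integral>x. f x \<partial>\<mu>s i) \<longlongrightarrow> (\<integral>x. f x \<partial>\<mu>)) F)"
  (is "?L \<longleftrightarrow> ?R")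
proof
  assume L: ?L
  then have \<mu>: "\<mu> \<in> prob_measures X" by (simp add: limitin_def)
  have ev: "\<forall>\<^sub>F i in F. \<mu>s i \<in> prob_measures X"
    using L \<mu> openin_topspace[of "weak_topology X"] by (simp add: limitin_def)
  have "((\<lambda>i. \<integral>x. f x \<partial>\<mu>s i) \<longlongrightarrow> (\<integral>x. f x \<partial>\<mu>)) F" if f: "f \<in> bounded_cont X" for f
  proof (rule topological_tendstoI)
    fix U :: "real set" assume U: "open U" "(\<integral>x. f x \<partial>\<mu>) \<in> U"
    have "openin (weak_topology X) {\<mu> \<in> prob_measures X. (\<integral>x. f x \<partial>\<mu>) \<in> U}"
      unfolding weak_topology_def by (rule topology_generated_by_Basis) (use f U in blast)
    moreover have "\<mu> \<in> {\<mu> \<in> prob_measures X. (\<integral>x. f x \<partial>\<mu>) \<in> U}"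
      using U \<mu> by simp
    ultimately have "\<forall>\<^sub>F i in F. \<mu>s i \<in> {\<mu> \<in> prob_measures X. (\<integral>x. f x \<partial>\<mu>) \<in> U}"
      using L unfolding limitin_def by blast
    then show "\<forall>\<^sub>F i in F. (\<integral>x. f x \<partial>\<mu>s i) \<in> U"
      by eventually_elim simp
  qed
  with \<mu> ev show ?R by blast
next
  assume R: ?R
  have "\<forall>\<^sub>F i in F. \<mu>s i \<in> V"
    if "generate_topology_on
          {{\<mu> \<in> prob_measures X. (\<integral>x. f x \<partial>\<mu>) \<in> U} | f U. f \<in> bounded_cont X \<and> open U} V"
      and "\<mu> \<in> V" for V
    using that
  proof (induction rule: generate_topology_on.induct)
    case Empty
    then show ?case by simp
  next
    case (Int a b)
    then show ?case by (auto intro: eventually_conj)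
  next
    case (UN K)
    then obtain k where "k \<in> K" "\<mu> \<in> k" by blast
    then have "\<forall>\<^sub>F i in F. \<mu>s i \<in> k" using UN by blast
    then show ?case by eventually_elim (use \<open>k \<in> K\<close> in blast)
  next
    case (Basis s)
    then obtain f U where s: "s = {\<mu> \<in> prob_measures X. (\<integral>x. f x \<partial>\<mu>) \<in> U}"
      and f: "f \<in> bounded_cont X" and U: "open U" by blast
    have "\<forall>\<^sub>F i in F. (\<integral>x. f x \<partial>\<mu>s i) \<in> U"
      using R f U Basis s by (intro topological_tendstoD) auto
    moreover have "\<forall>\<^sub>F i in F. \<mu>s i \<in> prob_measures X" using R by blast
    ultimately show ?case by eventually_elim (simp add: s)
  qed
  with R show ?L
    by (simp add: limitin_def)
       (simp add: weak_topology_def openin_topology_generated_by_iff)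
qed

end

theory Submission
  imports Defs "HOL-Library.Diagonal_Subsequence"
begin

text \<open>Write \<open>R(\<cdot>|s)\<close> for the joint kernel at \<open>s = (z, y, a)\<close>, \<open>\<mu>\<^sub>s\<close> for its marginal on \<open>Y\<close> and
  \<open>H\<^sub>s\<close> for the filter.  For \<open>F(\<nu>) = \<integral>f d\<nu>\<close> one has
  \<open>\<integral>F(\<nu>) q(d\<nu>, B|s) = \<integral>\<^sub>B F(H\<^sub>s) d\<mu>\<^sub>s = \<integral>f(w) R(dw, B|s)\<close>, and \<open>R\<close> at a Dirac measure is \<open>P\<close>; hence the
  property passes from \<open>q\<close> to \<open>P\<close>.  Conversely, if \<open>P\<close> is semi-uniform Feller, then the functions
  \<open>w \<mapsto> \<integral>f(w') P(dw', B|w, y, a)\<close> are equicontinuous uniformly in \<open>B\<close>, so the property passes to \<open>R\<close>.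
  With \<open>f = 1\<close> this makes \<open>\<mu>\<^sub>s\<close> continuous in total variation, and then \<open>\<integral>f dH\<^sub>s\<close> is continuous in
  \<open>L\<^sup>1\<close> along every convergent sequence.  Since countably many \<open>f\<close> determine weak convergence, along
  a subsequence the filters converge weakly almost surely, and dominated convergence gives the claim
  for \<open>q\<close>.\<close>

subsection \<open>Slices and semi-uniform convergence\<close>


text \<open>The supremum over \<open>B\<close> rules out arguing one set at a time; it is traded for
  norms. Uniformly small set integrals under one measure amount to an L1 bound, by testing the sets
  where the integrand is nonnegative and where it is negative, and an L1 bound in turn is uniform in
  \<open>B\<close>. The filters are compared under the limit marginal only; total variation pays for
  the change of measure. Every test function brings its own null set, so countably many must
  suffice, and almost sure convergence is available only along subsequences, so the L1 claim for a
  general weakly continuous \<open>F\<close> is proved by contradiction. The step from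
  \<open>P\<close> to the joint kernel moves the integrand and the measure \<open>z\<close> at once,
  and no compactness of the state space is at hand. A partition of unity on finitely many members of
  a countable cover by small balls is used instead; it misses only a small mass of the limit
  measure. A kernel is measurable for the evaluations \<nu> \<mapsto> \<nu>(E), whereas
  \<open>F\<close> is measurable for the weak Borel sets; a countable base links the two.\<close>

lemma bounded_contE:
  assumes "f \<in> bounded_cont X"
  obtains C where "0 < C" "\<And>x. x \<in> topspace X \<Longrightarrow> \<bar>f x\<bar> \<le> C"
  using assms unfolding bounded_cont_def bounded_pos by auto

lemma borel_measurable_bounded_cont:
  assumes "f \<in> bounded_cont X"
  shows "f \<in> borel_measurable (borel_of X)"
proof -
  have "sets (borel_of euclideanreal) = sets borel"
    by (simp add: sets_borel_of borel_def)
  then show ?thesis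
    using borel_of_measurable_continuous[of X euclideanreal f] assms measurable_cong_sets
    unfolding bounded_cont_def by blast
qed

lemma prob_measuresD:
  assumes "\<mu> \<in> prob_measures X"
  shows "prob_space \<mu>" "sets \<mu> = sets (borel_of X)" "space \<mu> = topspace X"
  using assms sets_eq_imp_space_eq[of \<mu> "borel_of X"] by (auto simp: prob_measures_def)

lemma space_prob_algebra_borel_of: "space (prob_algebra (borel_of X)) = prob_measures X"
  by (auto simp: space_prob_algebra prob_measures_def)

lemma (in finite_measure) integrable_abs_bounded:
  fixes f :: "'a \<Rightarrow> real"
  assumes "f \<in> borel_measurable M" "\<And>x. x \<in> space M \<Longrightarrow> \<bar>f x\<bar> \<le> C"
  shows "integrable M f"
  using assms by (intro integrable_const_bound[of _ C]) auto

lemma (in subprob_space) abs_integral_le_bound: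
  fixes f :: "'a \<Rightarrow> real"
  assumes f: "f \<in> borel_measurable M" "\<And>x. x \<in> space M \<Longrightarrow> \<bar>f x\<bar> \<le> C" and C: "0 \<le> C"
  shows "\<bar>\<integral>x. f x \<partial>M\<bar> \<le> C"
proof -
  have "\<bar>\<integral>x. f x \<partial>M\<bar> \<le> (\<integral>x. \<bar>f x\<bar> \<partial>M)" by (rule integral_abs_bound)
  also have "\<dots> \<le> (\<integral>x. C \<partial>M)"
    using f integrable_abs_bounded[OF f] by (intro integral_mono) auto
  also have "\<dots> = C * measure M (space M)" by simp
  also have "\<dots> \<le> C * 1"
    using C subprob_measure_le_1 by (intro mult_left_mono)
  finally show ?thesis by simp
qed

lemma emeasure_fst_slice_le:
  assumes \<mu>: "\<mu> \<in> prob_measures (prod_topology X1 X2)" and B: "B \<in> sets (borel_of X2)"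
  shows "emeasure (fst_slice X1 \<mu> B) (space (fst_slice X1 \<mu> B)) \<le> 1"
proof -
  interpret prob_space \<mu> using prob_measuresD(1)[OF \<mu>] .
  have [simp]: "space (fst_slice X1 \<mu> B) = topspace X1"
    using sets_eq_imp_space_eq[OF sets_fst_slice] by simp
  show ?thesis
    using emeasure_fst_slice[OF prob_measuresD(2)[OF \<mu>] B sets.top] emeasure_le_1 by simp
qed

lemma subprob_space_fst_slice:
  assumes \<mu>: "\<mu> \<in> prob_measures (prod_topology X1 X2)" and B: "B \<in> sets (borel_of X2)"
  shows "subprob_space (fst_slice X1 \<mu> B)"
proof (rule subprob_spaceI[OF emeasure_fst_slice_le[OF assms]])
  show "space (fst_slice X1 \<mu> B) \<noteq> {}"
    using prob_space.not_empty[OF prob_measuresD(1)[OF \<mu>]] prob_measuresD(3)[OF \<mu>]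
      sets_eq_imp_space_eq[OF sets_fst_slice, of X1 \<mu> B] by auto
qed

lemma abs_integral_fst_slice_le:
  fixes f :: "'a \<Rightarrow> real"
  assumes "\<mu> \<in> prob_measures (prod_topology X1 X2)" "B \<in> sets (borel_of X2)"
    and "f \<in> borel_measurable (borel_of X1)" "\<And>x. x \<in> topspace X1 \<Longrightarrow> \<bar>f x\<bar> \<le> C" "0 \<le> C"
  shows "\<bar>\<integral>x. f x \<partial>(fst_slice X1 \<mu> B)\<bar> \<le> C"
  using assms sets_eq_imp_space_eq[OF sets_fst_slice, of X1 \<mu> B]
  by (intro subprob_space.abs_integral_le_bound[OF subprob_space_fst_slice[OF assms(1,2)]])
     (auto simp: measurable_cong_sets[OF sets_fst_slice refl])

text \<open>A real supremum says something only for a set that is bounded above; here twice a bound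
  of \<open>f\<close> serves, since slices have mass at most 1. The right-hand side also asks the
  whole sequence to lie in \<open>X3\<close>, which \<open>limitin\<close> grants only eventually,
  so that later the kernel can be evaluated at every index.\<close>

lemma semi_uniform_Feller_iff:
  fixes X1 :: "'a topology" and X2 :: "'b topology" and X3 :: "'s topology"
  assumes "K \<in> topspace X3 \<rightarrow> prob_measures (prod_topology X1 X2)"
  shows "semi_uniform_Feller X1 X2 X3 K \<longleftrightarrow>
    (\<forall>\<sigma> s f e. range \<sigma> \<subseteq> topspace X3 \<longrightarrow> limitin X3 \<sigma> s sequentially \<longrightarrow> f \<in> bounded_cont X1 \<longrightarrow> 0 < e \<longrightarrow>
      (\<forall>\<^sub>F n in sequentially. \<forall>B \<in> sets (borel_of X2).
        \<bar>(\<integral>x. f x \<partial>(fst_slice X1 (K (\<sigma> n)) B)) - (\<integral>x. f x \<partial>(fst_slice X1 (K s) B))\<bar> \<le> e))"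
proof -
  note K = funcset_mem[OF assms]
  define d where "d f \<sigma> s n B = \<bar>(\<integral>x. f x \<partial>(fst_slice X1 (K (\<sigma> n)) B)) - (\<integral>x. f x \<partial>(fst_slice X1 (K s) B))\<bar>"
    for f :: "'a \<Rightarrow> real" and \<sigma> s and n :: nat and B
  have bdd: "bdd_above (d f \<sigma> s n ` sets (borel_of X2))"
    if f: "f \<in> bounded_cont X1" and *: "\<sigma> n \<in> topspace X3" "s \<in> topspace X3" for f \<sigma> s n
  proof -
    obtain C where C: "0 < C" "\<And>x. x \<in> topspace X1 \<Longrightarrow> \<bar>f x\<bar> \<le> C" using bounded_contE[OF f] by metis
    have "d f \<sigma> s n B \<le> C + C" if "B \<in> sets (borel_of X2)" for B
      using abs_integral_fst_slice_le[OF K[OF *(1)] that borel_measurable_bounded_cont[OF f] C(2)]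
        abs_integral_fst_slice_le[OF K[OF *(2)] that borel_measurable_bounded_cont[OF f] C(2)] C(1)
      unfolding d_def by linarith
    then show ?thesis by (auto intro!: bdd_aboveI)
  qed
  have ne: "sets (borel_of X2) \<noteq> {}" by auto
  show ?thesis
    unfolding semi_uniform_Feller_def d_def[symmetric]
  proof (intro iffI allI impI ballI)
    fix \<sigma> s f and e :: real
    assume L: "\<forall>\<sigma> s. limitin X3 \<sigma> s sequentially \<longrightarrow>
       (\<forall>f\<in>bounded_cont X1. (\<lambda>n. \<Squnion> (d f \<sigma> s n ` sets (borel_of X2))) \<longlonglongrightarrow> 0)"
      and *: "range \<sigma> \<subseteq> topspace X3" "limitin X3 \<sigma> s sequentially" "f \<in> bounded_cont X1" "0 < e"
    have s: "s \<in> topspace X3" using *(2) by (simp add: limitin_def)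
    have "\<forall>\<^sub>F n in sequentially. \<Squnion> (d f \<sigma> s n ` sets (borel_of X2)) < e"
      using L *(2-4) by (intro order_tendstoD) auto
    then show "\<forall>\<^sub>F n in sequentially. \<forall>B \<in> sets (borel_of X2). d f \<sigma> s n B \<le> e"
    proof eventually_elim
      case (elim n)
      show ?case
      proof
        fix B assume "B \<in> sets (borel_of X2)"
        then have "d f \<sigma> s n B \<le> \<Squnion> (d f \<sigma> s n ` sets (borel_of X2))"
          using * s by (intro cSUP_upper bdd) auto
        with elim show "d f \<sigma> s n B \<le> e" by simp
      qed
    qed
  next
    fix \<sigma> s f
    assume R: "\<forall>\<sigma> s f e. range \<sigma> \<subseteq> topspace X3 \<longrightarrow> limitin X3 \<sigma> s sequentially \<longrightarrow>
        f \<in> bounded_cont X1 \<longrightarrow> 0 < e \<longrightarrow>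
        (\<forall>\<^sub>F n in sequentially. \<forall>B \<in> sets (borel_of X2). d f \<sigma> s n B \<le> e)"
      and *: "limitin X3 \<sigma> s sequentially" "f \<in> bounded_cont X1"
    have s: "s \<in> topspace X3" and ev: "\<forall>\<^sub>F n in sequentially. \<sigma> n \<in> topspace X3"
      using *(1) by (auto simp: limitin_def)
    \<comment> \<open>Terms outside \<open>X3\<close> are replaced by the limit; they do not occur
      in the tail, so neither the limit nor the claim changes.\<close>
    define \<sigma>' where "\<sigma>' n = (if \<sigma> n \<in> topspace X3 then \<sigma> n else s)" for n
    have eq: "\<forall>\<^sub>F n in sequentially. \<sigma> n = \<sigma>' n"
      using ev by eventually_elim (simp add: \<sigma>'_def)
    have lim': "limitin X3 \<sigma>' s sequentially"
      by (rule limitin_transform_eventually[OF eq *(1)])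
    have ran: "range \<sigma>' \<subseteq> topspace X3" using s by (auto simp: \<sigma>'_def)
    show "(\<lambda>n. \<Squnion> (d f \<sigma> s n ` sets (borel_of X2))) \<longlonglongrightarrow> 0"
    proof (rule tendstoI)
      fix e :: real assume e: "0 < e"
      have "\<forall>\<^sub>F n in sequentially. \<forall>B \<in> sets (borel_of X2). d f \<sigma>' s n B \<le> e / 2"
        using R[rule_format, OF ran lim' *(2), of "e/2"] e by simp
      with eq ev show "\<forall>\<^sub>F n in sequentially. dist (\<Squnion> (d f \<sigma> s n ` sets (borel_of X2))) 0 < e"
      proof eventually_elim
        case (elim n)
        have "\<forall>B \<in> sets (borel_of X2). d f \<sigma> s n B \<le> e / 2"
          using elim(1,3) by (simp add: d_def)
        then have 1: "\<Squnion> (d f \<sigma> s n ` sets (borel_of X2)) \<le> e / 2"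
          using ne by (intro cSUP_least) auto
        \<comment> \<open>The empty set is a convenient index that shows the supremum to be
          nonnegative, so the upper bound alone controls its distance to 0.\<close>
        have "0 \<le> d f \<sigma> s n {}" by (simp add: d_def)
        also have "\<dots> \<le> \<Squnion> (d f \<sigma> s n ` sets (borel_of X2))"
          using elim(2) s *(2) by (intro cSUP_upper bdd) auto
        finally show ?case using 1 e by simp
      qed
    qed
  qed
qed

subsection \<open>A countable base of the weak topology\<close>


text \<open>The start value 0 makes the empty list the zero function and every value nonnegative, so
  a list of minorants of a nonnegative function is sent to a minorant between 0 and that
  function.\<close>

definition list_max :: "('a \<Rightarrow> real) list \<Rightarrow> 'a \<Rightarrow> real" where
  "list_max bs w = foldr (\<lambda>b. max (b w)) bs 0"

lemma list_max_le_iff: "list_max bs w \<le> c \<longleftrightarrow> 0 \<le> c \<and> (\<forall>b \<in> set bs. b w \<le> c)"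
  by (induction bs) (auto simp: list_max_def)

lemma continuous_on_list_max:
  "(\<And>b. b \<in> set bs \<Longrightarrow> continuous_on S b) \<Longrightarrow> continuous_on S (list_max bs)"
proof (induction bs)
  case Nil
  then show ?case by (simp add: list_max_def[abs_def])
next
  case (Cons b bs)
  then have "continuous_on S (\<lambda>w. max (b w) (list_max bs w))"
    by (intro continuous_on_max) auto
  then show ?case by (simp add: list_max_def[abs_def])
qed

text \<open>For \<open>r > 0\<close> this is 1 within distance \<open>r\<close> of \<open>x\<close>,
  vanishes from distance \<open>2 * r\<close> on, and is linear in the distance in between. For
  \<open>r \<le> 0\<close> it is the constant 1.\<close>

definition bump :: "'a::metric_space \<Rightarrow> real \<Rightarrow> 'a \<Rightarrow> real" where
  "bump x r w = max 0 (min 1 (2 - dist w x / r))"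

lemma bump_bounds: "0 \<le> bump x r w" "bump x r w \<le> 1"
  by (auto simp: bump_def)

lemma continuous_on_bump: "continuous_on S (bump x r)"
  unfolding bump_def[abs_def] divide_inverse by (intro continuous_intros)

text \<open>By continuity \<open>f\<close> stays above a rational \<open>q\<close> between
  \<open>t\<close> and \<open>f w\<close> on a ball of radius \<delta> about \<open>w\<close>. If
  the centre \<open>x\<close> is closer than \<open>r\<close> to \<open>w\<close>, the bump is 1 at
  \<open>w\<close> and its support lies within \<open>3 * r < \<delta>\<close> of \<open>w\<close>,
  so \<open>q\<close> times the bump stays below \<open>f\<close>. Centre, radius and height range
  over countable sets.\<close>

lemma bump_minorant_exists:
  fixes f :: "'a::metric_space \<Rightarrow> real"
  assumes f: "continuous_on S f" "\<And>x. x \<in> S \<Longrightarrow> 0 \<le> f x"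
    and D: "\<And>X. open X \<Longrightarrow> X \<noteq> {} \<Longrightarrow> \<exists>d \<in> D. d \<in> X"
    and w: "w \<in> S" and t: "0 \<le> t" "t < f w"
  shows "\<exists>x \<in> D. \<exists>r \<in> \<rat>. \<exists>q \<in> \<rat>. 0 \<le> q \<and> (\<forall>v \<in> S. q * bump x r v \<le> f v) \<and> t < q * bump x r w"
proof -
  obtain q where q: "q \<in> \<rat>" "t < q" "q < f w" using Rats_dense_in_real[OF t(2)] by blast
  obtain \<delta> where \<delta>: "0 < \<delta>" "\<And>v. v \<in> S \<Longrightarrow> dist v w < \<delta> \<Longrightarrow> dist (f v) (f w) < f w - q"
    using f(1) w q(3) unfolding continuous_on_iff by (metis diff_gt_0_iff_gt)
  obtain r where r: "r \<in> \<rat>" "0 < r" "r < \<delta> / 3" using Rats_dense_in_real[of 0 "\<delta> / 3"] \<delta>(1) by auto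
  obtain x where x: "x \<in> D" "dist w x < r" using D[of "ball w r"] r by auto
  have "q * bump x r v \<le> f v" if v: "v \<in> S" for v
  proof (cases "bump x r v = 0")
    case True
    then show ?thesis using f(2)[OF v] by simp
  next
    case False
    then have "dist v x < 2 * r" using r(2) by (auto simp: bump_def max_def min_def field_simps split: if_splits)
    then have "dist v w < \<delta>" using x r dist_triangle[of v w x] by (simp add: dist_commute)
    then have "q < f v" using \<delta>(2)[OF v] by (auto simp: dist_real_def)
    moreover have "q * bump x r v \<le> q * 1"
      using q t by (intro mult_left_mono bump_bounds) auto
    ultimately show ?thesis by simp
  qed
  moreover have "bump x r w = 1" using x r by (simp add: bump_def field_simps)
  ultimately show ?thesis using x(1) r(1) q t by (intro bexI[of _ x] bexI[of _ r] bexI[of _ q]) auto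
qed

lemma bounded_cont_top_of_set:
  "f \<in> bounded_cont (top_of_set S) \<longleftrightarrow> continuous_on S f \<and> bounded (f ` S)"
  by (simp add: bounded_cont_def)

lemma integrable_bounded_cont:
  assumes "f \<in> bounded_cont X" "\<mu> \<in> prob_measures X"
  shows "integrable \<mu> f"
proof -
  interpret prob_space \<mu> using prob_measuresD(1)[OF assms(2)] .
  obtain C where "\<And>x. x \<in> topspace X \<Longrightarrow> \<bar>f x\<bar> \<le> C" using bounded_contE[OF assms(1)] by metis
  then show ?thesis
    using borel_measurable_bounded_cont[OF assms(1)] prob_measuresD(2,3)[OF assms(2)]
    by (intro integrable_abs_bounded[of _ C]) (auto cong: measurable_cong_sets)
qed

text \<open>The witness consists of the finite maxima of rational multiples of bump functions: those lying
  below a nonnegative continuous \<open>f\<close> have pointwise supremum \<open>f\<close>.\<close>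

lemma countable_lower_approximation:
  fixes S :: "'a::{metric_space, second_countable_topology} set"
  obtains G where "countable G" "G \<subseteq> bounded_cont (top_of_set S)"
    "\<And>f \<mu> t. f \<in> bounded_cont (top_of_set S) \<Longrightarrow> (\<And>x. x \<in> S \<Longrightarrow> 0 \<le> f x) \<Longrightarrow>
       \<mu> \<in> prob_measures (top_of_set S) \<Longrightarrow> t < (\<integral>x. f x \<partial>\<mu>) \<Longrightarrow>
       \<exists>g \<in> G. (\<forall>x \<in> S. g x \<le> f x) \<and> t < (\<integral>x. g x \<partial>\<mu>)"
proof -
  obtain D :: "'a set" where D: "countable D" "\<And>X. open X \<Longrightarrow> X \<noteq> {} \<Longrightarrow> \<exists>d \<in> D. d \<in> X"
    by (rule countable_dense_setE) blast
  define B where "B = (\<lambda>(x, r, q) w. q * bump x r w) ` (D \<times> \<rat> \<times> {q \<in> \<rat>. 0 \<le> q})"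
  have cB: "countable B"
    unfolding B_def using D(1) countable_rat by (intro countable_image countable_SIGMA) (auto intro: countable_subset)
  define G where "G = list_max ` lists B"
  have B: "continuous_on S b \<and> bounded (b ` S)" if bB: "b \<in> B" for b
  proof -
    obtain x r q where b: "b = (\<lambda>w. q * bump x r w)" "0 \<le> q" using bB by (auto simp: B_def)
    have "\<bar>b w\<bar> \<le> q * 1" for w
      using b bump_bounds[of x r w] mult_left_mono[OF bump_bounds(2) b(2), of x r w] by auto
    then show ?thesis using b by (auto intro!: boundedI continuous_intros continuous_on_bump)
  qed
  have "bounded (list_max bs ` S)" if "bs \<in> lists B" for bs
    using that
  proof induction
    case Nil
    then show ?case by (auto simp: list_max_def intro!: boundedI)
  next
    case (Cons b bs)
    then obtain c1 c2 where "\<forall>w \<in> S. \<bar>b w\<bar> \<le> c1" "\<forall>w \<in> S. \<bar>list_max bs w\<bar> \<le> c2"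
      using B unfolding bounded_iff by (metis image_eqI real_norm_def)
    then have "\<forall>w\<in>S. \<bar>list_max (b # bs) w\<bar> \<le> c1 + c2"
      by (force simp: list_max_def max_def)
    then show ?case by (auto intro!: boundedI)
  qed
  moreover have "continuous_on S (list_max bs)" if "bs \<in> lists B" for bs
    using B that by (intro continuous_on_list_max) auto
  ultimately have G_sub: "G \<subseteq> bounded_cont (top_of_set S)"
    unfolding G_def bounded_cont_top_of_set[abs_def] subset_iff image_iff
    by (metis (no_types, lifting) bounded_cont_top_of_set)
  have approx: "\<exists>g \<in> G. (\<forall>x \<in> S. g x \<le> f x) \<and> t < (\<integral>x. g x \<partial>\<mu>)"
    if f: "f \<in> bounded_cont (top_of_set S)" "\<And>x. x \<in> S \<Longrightarrow> 0 \<le> f x"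
      and \<mu>: "\<mu> \<in> prob_measures (top_of_set S)" and t: "t < (\<integral>x. f x \<partial>\<mu>)" for f \<mu> t
  proof -
    define Bf where "Bf = {b \<in> B. \<forall>x \<in> S. b x \<le> f x}"
    have cBf: "countable Bf" using cB by (simp add: Bf_def)
    \<comment> \<open>Multiplying by 0 gives the zero function, which lies below every nonnegative
      \<open>f\<close>; so \<open>Bf\<close> is nonempty and \<open>from_nat_into\<close> enumerates
      it.\<close>
    obtain d where "d \<in> D" using D(2)[of UNIV] by auto
    then have "(\<lambda>w. 0 * bump d 0 w) \<in> B" unfolding B_def by force
    then have ne: "Bf \<noteq> {}" using f(2) by (auto simp: Bf_def)
    define g where "g n = list_max (map (from_nat_into Bf) [0..<n])" for n
    have gB: "set (map (from_nat_into Bf) [0..<n]) \<subseteq> Bf" for n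
      using from_nat_into[OF ne] by auto
    have gG: "g n \<in> G" for n
    proof -
      have "Bf \<subseteq> B" by (auto simp: Bf_def)
      then show ?thesis using gB[of n] unfolding g_def G_def in_lists_conv_set by (intro imageI in_listsI) blast
    qed
    have g0: "0 \<le> g n x" for n x
      using list_max_le_iff[of _ x "g n x"] by (auto simp: g_def)
    have gle: "g n x \<le> f x" if "x \<in> S" for n x
      using gB[of n] f(2)[OF that] that by (auto simp: g_def list_max_le_iff Bf_def)
    have conv: "(\<lambda>n. g n x) \<longlonglongrightarrow> f x" if x: "x \<in> S" for x
    proof (rule increasing_tendsto)
      show "\<forall>\<^sub>F n in sequentially. g n x \<le> f x" using gle[OF x] by simp
      fix s assume s: "s < f x"
      show "\<forall>\<^sub>F n in sequentially. s < g n x"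
      proof (cases "0 \<le> s")
        case False
        \<comment> \<open>A negative level is exceeded by every \<open>g n\<close>, since
          \<open>list_max\<close> is nonnegative; only levels \<open>s \<ge> 0\<close> call for a
          bump.\<close>
        then show ?thesis using g0[of _ x] by (intro always_eventually allI) (meson less_le_trans not_le)
      next
        case True
        obtain y r q where "y \<in> D" "r \<in> \<rat>" "q \<in> \<rat>" "0 \<le> q"
          "\<forall>v \<in> S. q * bump y r v \<le> f v" and sb: "s < q * bump y r x"
          using bump_minorant_exists[of S f D x s] f D(2) x True s unfolding bounded_cont_top_of_set by blast
        then have "(\<lambda>v. q * bump y r v) \<in> Bf" unfolding Bf_def B_def by force
        then obtain i where i: "from_nat_into Bf i = (\<lambda>v. q * bump y r v)"
          using from_nat_into_surj[OF cBf] by blast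
        have "s < g n x" if "i < n" for n
        proof -
          have "from_nat_into Bf i x \<le> g n x"
            using list_max_le_iff[of "map (from_nat_into Bf) [0..<n]" x "g n x"] that by (simp add: g_def)
          then show ?thesis using sb i by simp
        qed
        then show ?thesis by (auto simp: eventually_at_top_dense)
      qed
    qed
    have "(\<lambda>n. \<integral>x. g n x \<partial>\<mu>) \<longlonglongrightarrow> (\<integral>x. f x \<partial>\<mu>)"
    proof (rule integral_dominated_convergence)
      show "integrable \<mu> f" by (rule integrable_bounded_cont[OF f(1) \<mu>])
      then show "f \<in> borel_measurable \<mu>" by auto
      show "g n \<in> borel_measurable \<mu>" for n
        using integrable_bounded_cont[OF _ \<mu>] gG G_sub by blast
      have sp: "space \<mu> = S" using prob_measuresD(3)[OF \<mu>] by simp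
      show "AE x in \<mu>. (\<lambda>n. g n x) \<longlonglongrightarrow> f x" using conv sp by auto
      show "AE x in \<mu>. norm (g n x) \<le> f x" for n using g0 gle sp by auto
    qed
    then have "\<forall>\<^sub>F n in sequentially. t < (\<integral>x. g n x \<partial>\<mu>)" using t by (rule order_tendstoD)
    then obtain n where "t < (\<integral>x. g n x \<partial>\<mu>)" by (auto simp: eventually_sequentially)
    then show ?thesis using gG[of n] gle by blast
  qed
  show thesis
  proof (rule that[OF _ G_sub approx])
    show "countable G" unfolding G_def using cB by (intro countable_image countable_lists)
  qed
qed

text \<open>The sets {\<nu>. t < \<integral>g d\<nu>} with \<open>g\<close> in \<open>G\<close> and
  rational \<open>t\<close> form a countable subbase of the weak topology, and two of them already
  fit into a prescribed neighbourhood given by a single test function. This form serves both the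
  criterion for convergence and the construction of a countable base.\<close>

lemma countable_weak_neighbourhoods:
  fixes S :: "'a::{metric_space, second_countable_topology} set"
  obtains G where "countable G" "G \<subseteq> bounded_cont (top_of_set S)"
    "\<forall>f \<in> bounded_cont (top_of_set S). \<forall>\<mu> \<in> prob_measures (top_of_set S). \<forall>e > 0.
       \<exists>g1 \<in> G. \<exists>t1 \<in> \<rat>. \<exists>g2 \<in> G. \<exists>t2 \<in> \<rat>. t1 < (\<integral>x. g1 x \<partial>\<mu>) \<and> t2 < (\<integral>x. g2 x \<partial>\<mu>) \<and>
         (\<forall>\<nu> \<in> prob_measures (top_of_set S). t1 < (\<integral>x. g1 x \<partial>\<nu>) \<longrightarrow> t2 < (\<integral>x. g2 x \<partial>\<nu>) \<longrightarrow>
            \<bar>(\<integral>x. f x \<partial>\<nu>) - (\<integral>x. f x \<partial>\<mu>)\<bar> < e)"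
proof -
  let ?X = "top_of_set S"
  obtain G where G: "countable G" "G \<subseteq> bounded_cont ?X"
    "\<And>f \<mu> t. f \<in> bounded_cont ?X \<Longrightarrow> (\<And>x. x \<in> S \<Longrightarrow> 0 \<le> f x) \<Longrightarrow>
       \<mu> \<in> prob_measures ?X \<Longrightarrow> t < (\<integral>x. f x \<partial>\<mu>) \<Longrightarrow>
       \<exists>g \<in> G. (\<forall>x \<in> S. g x \<le> f x) \<and> t < (\<integral>x. g x \<partial>\<mu>)"
    using countable_lower_approximation[of S] by blast
  show thesis
  proof (rule that[OF G(1,2)], intro ballI allI impI)
    fix f \<mu> and e :: real
    assume f: "f \<in> bounded_cont ?X" and \<mu>: "\<mu> \<in> prob_measures ?X" and e: "0 < e"
    obtain C where C: "\<And>x. x \<in> S \<Longrightarrow> \<bar>f x\<bar> \<le> C" using bounded_contE[OF f] by auto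
    \<comment> \<open>lower approximations of \<open>f + C\<close> and \<open>C - f\<close> control \<open>\<integral>f d\<nu>\<close> from both sides\<close>
    have side: "\<exists>g \<in> G. \<exists>t \<in> \<rat>. t < (\<integral>x. g x \<partial>\<mu>) \<and>
      (\<forall>\<nu> \<in> prob_measures ?X. t < (\<integral>x. g x \<partial>\<nu>) \<longrightarrow> s * (\<integral>x. f x \<partial>\<mu>) - e < s * (\<integral>x. f x \<partial>\<nu>))"
      if s: "s = 1 \<or> s = -1" for s :: real
    proof -
      have int: "(\<integral>x. s * f x + C \<partial>\<nu>) = s * (\<integral>x. f x \<partial>\<nu>) + C" if \<nu>: "\<nu> \<in> prob_measures ?X" for \<nu>
      proof -
        interpret prob_space \<nu> using prob_measuresD(1)[OF \<nu>] .
        show ?thesis using integrable_bounded_cont[OF f \<nu>] by (simp add: prob_space)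
      qed
      have "\<bar>s * f x + C\<bar> \<le> C + C" if "x \<in> S" for x using s C[OF that] by auto
      then have h: "(\<lambda>x. s * f x + C) \<in> bounded_cont ?X"
        using f by (auto simp: bounded_cont_top_of_set intro!: continuous_intros boundedI)
      have "s * (\<integral>x. f x \<partial>\<mu>) + C - e < (\<integral>x. s * f x + C \<partial>\<mu>)" using int[OF \<mu>] e by simp
      then obtain g where g: "g \<in> G" "\<forall>x \<in> S. g x \<le> s * f x + C" "s * (\<integral>x. f x \<partial>\<mu>) + C - e < (\<integral>x. g x \<partial>\<mu>)"
        using G(3)[OF h _ \<mu>] s C by force
      obtain t where t: "t \<in> \<rat>" "s * (\<integral>x. f x \<partial>\<mu>) + C - e < t" "t < (\<integral>x. g x \<partial>\<mu>)"
        using Rats_dense_in_real[OF g(3)] by blast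
      have "s * (\<integral>x. f x \<partial>\<mu>) - e < s * (\<integral>x. f x \<partial>\<nu>)"
        if \<nu>: "\<nu> \<in> prob_measures ?X" "t < (\<integral>x. g x \<partial>\<nu>)" for \<nu>
      proof -
        have "(\<integral>x. g x \<partial>\<nu>) \<le> (\<integral>x. s * f x + C \<partial>\<nu>)"
          using g G(2) h \<nu> prob_measuresD(3)[OF \<nu>(1)]
          by (intro integral_mono integrable_bounded_cont[of _ ?X]) auto
        then show ?thesis using int[OF \<nu>(1)] t \<nu> by simp
      qed
      then show ?thesis using g(1) t by blast
    qed
    show "\<exists>g1 \<in> G. \<exists>t1 \<in> \<rat>. \<exists>g2 \<in> G. \<exists>t2 \<in> \<rat>. t1 < (\<integral>x. g1 x \<partial>\<mu>) \<and> t2 < (\<integral>x. g2 x \<partial>\<mu>) \<and>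
         (\<forall>\<nu> \<in> prob_measures (top_of_set S). t1 < (\<integral>x. g1 x \<partial>\<nu>) \<longrightarrow> t2 < (\<integral>x. g2 x \<partial>\<nu>) \<longrightarrow>
            \<bar>(\<integral>x. f x \<partial>\<nu>) - (\<integral>x. f x \<partial>\<mu>)\<bar> < e)"
    proof -
      obtain g1 t1 where 1: "g1 \<in> G" "t1 \<in> \<rat>" "t1 < (\<integral>x. g1 x \<partial>\<mu>)"
        "\<forall>\<nu> \<in> prob_measures ?X. t1 < (\<integral>x. g1 x \<partial>\<nu>) \<longrightarrow> (\<integral>x. f x \<partial>\<mu>) - e < (\<integral>x. f x \<partial>\<nu>)"
        using side[of 1] by auto
      obtain g2 t2 where 2: "g2 \<in> G" "t2 \<in> \<rat>" "t2 < (\<integral>x. g2 x \<partial>\<mu>)"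
        "\<forall>\<nu> \<in> prob_measures ?X. t2 < (\<integral>x. g2 x \<partial>\<nu>) \<longrightarrow> - (\<integral>x. f x \<partial>\<mu>) - e < - (\<integral>x. f x \<partial>\<nu>)"
        using side[of "-1"] by auto
      have "\<bar>(\<integral>x. f x \<partial>\<nu>) - (\<integral>x. f x \<partial>\<mu>)\<bar> < e"
        if "\<nu> \<in> prob_measures ?X" "t1 < (\<integral>x. g1 x \<partial>\<nu>)" "t2 < (\<integral>x. g2 x \<partial>\<nu>)" for \<nu>
        using 1(4)[rule_format, OF that(1,2)] 2(4)[rule_format, OF that(1,3)] by linarith
      then show ?thesis
        using 1(1-3) 2(1-3)
        by (intro bexI[of _ g1] bexI[of _ t1] bexI[of _ g2] bexI[of _ t2]) auto
    qed
  qed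
qed


text \<open>Convergence on \<open>G\<close> eventually puts \<open>\<nu> n\<close> into the two
  subbasic sets chosen around \<mu>, and these control an arbitrary test function. As
  \<open>G\<close> is fixed in advance and countable, almost sure convergence of each \<integral>g
  d\<nu> will yield almost sure weak convergence with only countably many null sets to
  discard.\<close>

lemma limitin_weak_topology_if_tendsto_on:
  fixes S :: "'a::{metric_space, second_countable_topology} set"
  obtains G where "countable G" "G \<subseteq> bounded_cont (top_of_set S)"
    "\<And>\<nu> \<mu>. \<mu> \<in> prob_measures (top_of_set S) \<Longrightarrow> (\<And>n. \<nu> n \<in> prob_measures (top_of_set S)) \<Longrightarrow>
       (\<And>g. g \<in> G \<Longrightarrow> (\<lambda>n. \<integral>x. g x \<partial>\<nu> n) \<longlonglongrightarrow> (\<integral>x. g x \<partial>\<mu>)) \<Longrightarrow>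
       limitin (weak_topology (top_of_set S)) \<nu> \<mu> sequentially"
proof -
  let ?X = "top_of_set S"
  obtain G where G: "countable G" "G \<subseteq> bounded_cont ?X" and
    nbh: "\<forall>f \<in> bounded_cont ?X. \<forall>\<mu> \<in> prob_measures ?X. \<forall>e > 0.
       \<exists>g1 \<in> G. \<exists>t1 \<in> \<rat>. \<exists>g2 \<in> G. \<exists>t2 \<in> \<rat>. t1 < (\<integral>x. g1 x \<partial>\<mu>) \<and> t2 < (\<integral>x. g2 x \<partial>\<mu>) \<and>
         (\<forall>\<nu> \<in> prob_measures ?X. t1 < (\<integral>x. g1 x \<partial>\<nu>) \<longrightarrow> t2 < (\<integral>x. g2 x \<partial>\<nu>) \<longrightarrow>
            \<bar>(\<integral>x. f x \<partial>\<nu>) - (\<integral>x. f x \<partial>\<mu>)\<bar> < e)"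
    by (rule countable_weak_neighbourhoods[of S]) (rule that)
  show thesis
  proof (rule that[OF G])
    fix \<nu> \<mu> assume \<mu>: "\<mu> \<in> prob_measures ?X" and \<nu>: "\<And>n. \<nu> n \<in> prob_measures ?X"
      and lim: "\<And>g. g \<in> G \<Longrightarrow> (\<lambda>n. \<integral>x. g x \<partial>\<nu> n) \<longlonglongrightarrow> (\<integral>x. g x \<partial>\<mu>)"
    have "(\<lambda>n. \<integral>x. f x \<partial>\<nu> n) \<longlonglongrightarrow> (\<integral>x. f x \<partial>\<mu>)" if f: "f \<in> bounded_cont ?X" for f
    proof (rule tendstoI)
      fix e :: real assume e: "0 < e"
      obtain g1 t1 g2 t2 where g: "g1 \<in> G" "g2 \<in> G" "t1 < (\<integral>x. g1 x \<partial>\<mu>)" "t2 < (\<integral>x. g2 x \<partial>\<mu>)"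
        and *: "\<And>\<nu>. \<nu> \<in> prob_measures ?X \<Longrightarrow> t1 < (\<integral>x. g1 x \<partial>\<nu>) \<Longrightarrow> t2 < (\<integral>x. g2 x \<partial>\<nu>) \<Longrightarrow>
            \<bar>(\<integral>x. f x \<partial>\<nu>) - (\<integral>x. f x \<partial>\<mu>)\<bar> < e"
        using nbh[rule_format, OF f \<mu> e] by metis
      show "\<forall>\<^sub>F n in sequentially. dist (\<integral>x. f x \<partial>\<nu> n) (\<integral>x. f x \<partial>\<mu>) < e"
        using order_tendstoD(1)[OF lim[OF g(1)] g(3)] order_tendstoD(1)[OF lim[OF g(2)] g(4)]
        by eventually_elim (simp add: dist_real_def * \<nu>)
    qed
    then show "limitin (weak_topology ?X) \<nu> \<mu> sequentially"
      using \<mu> \<nu> by (simp add: limitin_weak_topology)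
  qed
qed

text \<open>Finite intersections of the countable subbase do the job. Each subbasic set is
  measurable because \<nu> \<mapsto> \<integral>g d\<nu> is measurable for the sigma-algebra
  generated by the evaluations; that the intersections form a base follows by induction on the
  generation of open sets.\<close>

lemma weak_topology_countable_base:
  fixes S :: "'a::{metric_space, second_countable_topology} set"
  obtains \<B> where "countable \<B>" "\<B> \<subseteq> sets (prob_algebra (borel_of (top_of_set S)))"
    "\<And>V \<mu>. openin (weak_topology (top_of_set S)) V \<Longrightarrow> \<mu> \<in> V \<Longrightarrow> \<exists>U \<in> \<B>. \<mu> \<in> U \<and> U \<subseteq> V"
proof -
  let ?X = "top_of_set S" and ?P = "prob_measures (top_of_set S)"
  obtain G where G: "countable G" "G \<subseteq> bounded_cont ?X" and
    nbh: "\<forall>f \<in> bounded_cont ?X. \<forall>\<mu> \<in> ?P. \<forall>e > 0.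
       \<exists>g1 \<in> G. \<exists>t1 \<in> \<rat>. \<exists>g2 \<in> G. \<exists>t2 \<in> \<rat>. t1 < (\<integral>x. g1 x \<partial>\<mu>) \<and> t2 < (\<integral>x. g2 x \<partial>\<mu>) \<and>
         (\<forall>\<nu> \<in> ?P. t1 < (\<integral>x. g1 x \<partial>\<nu>) \<longrightarrow> t2 < (\<integral>x. g2 x \<partial>\<nu>) \<longrightarrow>
            \<bar>(\<integral>x. f x \<partial>\<nu>) - (\<integral>x. f x \<partial>\<mu>)\<bar> < e)"
    by (rule countable_weak_neighbourhoods[of S]) (rule that)
  define \<S> where "\<S> = (\<lambda>(g, t). {\<nu> \<in> ?P. t < (\<integral>x. g x \<partial>\<nu>)}) ` (G \<times> (\<rat> :: real set))"
  \<comment> \<open>Intersecting with \<open>?P\<close> matters for the empty family, whose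
    \<open>\<Inter>\<close> is the set of all measures.\<close>
  define \<B> where "\<B> = (\<lambda>\<F>. ?P \<inter> \<Inter>\<F>) ` {\<F>. finite \<F> \<and> \<F> \<subseteq> \<S>}"
  have cS: "countable \<S>"
    unfolding \<S>_def using G(1) countable_rat by (intro countable_image countable_SIGMA)
  have cB: "countable \<B>"
    unfolding \<B>_def by (intro countable_image countable_Collect_finite_subset cS)
  have sp: "space (prob_algebra (borel_of ?X)) = ?P"
    by (rule space_prob_algebra_borel_of)
  have S_sets: "s \<in> sets (prob_algebra (borel_of ?X))" if sS: "s \<in> \<S>" for s
  proof -
    obtain g t where s: "s = {\<nu> \<in> ?P. t < (\<integral>x. g x \<partial>\<nu>)}" and g: "g \<in> G" using sS by (auto simp: \<S>_def)
    have "(\<lambda>\<nu>. \<integral>x. g x \<partial>\<nu>) \<in> borel_measurable (prob_algebra (borel_of ?X))"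
      unfolding prob_algebra_def using borel_measurable_bounded_cont g G(2)
      by (intro measurable_restrict_space1 integral_measurable_subprob_algebra) blast
    from borel_measurable_const[THEN borel_measurable_less[OF _ this], of t] show ?thesis
      by (simp add: s sp)
  qed
  have B_sets: "U \<in> sets (prob_algebra (borel_of ?X))" if U: "U \<in> \<B>" for U
  proof -
    obtain \<F> where \<F>: "finite \<F>" "\<F> \<subseteq> \<S>" "U = ?P \<inter> \<Inter>\<F>" using U by (auto simp: \<B>_def)
    have "?P \<inter> \<Inter>\<F> \<in> sets (prob_algebra (borel_of ?X))"
      using \<F>(1,2)
    proof (induction \<F>)
      case empty
      then show ?case using sets.top[of "prob_algebra (borel_of ?X)"] sp by simp
    next
      case (insert s \<F>)
      then have "s \<inter> (?P \<inter> \<Inter>\<F>) \<in> sets (prob_algebra (borel_of ?X))"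
        using S_sets[of s] by auto
      then show ?case by (simp add: Int_left_commute)
    qed
    then show ?thesis using \<F>(3) by simp
  qed
  have base: "\<exists>U \<in> \<B>. \<mu> \<in> U \<and> U \<subseteq> V"
    if "generate_topology_on {{\<mu> \<in> ?P. (\<integral>x. f x \<partial>\<mu>) \<in> U} | f U. f \<in> bounded_cont ?X \<and> open U} V"
      "\<mu> \<in> V" for V \<mu>
    using that
  proof (induction rule: generate_topology_on.induct)
    case Empty
    then show ?case by simp
  next
    case (Int a b)
    then obtain U1 U2 where U: "U1 \<in> \<B>" "\<mu> \<in> U1" "U1 \<subseteq> a" "U2 \<in> \<B>" "\<mu> \<in> U2" "U2 \<subseteq> b" by blast
    then obtain F1 F2 where F: "finite F1" "F1 \<subseteq> \<S>" "finite F2" "F2 \<subseteq> \<S>"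
      and U_eq: "U1 = ?P \<inter> \<Inter>F1" "U2 = ?P \<inter> \<Inter>F2" by (auto simp: \<B>_def)
    have "U1 \<inter> U2 = ?P \<inter> \<Inter>(F1 \<union> F2)"
      by (simp only: U_eq Inter_Un_distrib Int_ac Int_absorb)
    moreover have "finite (F1 \<union> F2) \<and> F1 \<union> F2 \<subseteq> \<S>" using F by simp
    ultimately have "U1 \<inter> U2 \<in> \<B>"
      unfolding \<B>_def by (intro image_eqI[of _ _ "F1 \<union> F2"] CollectI)
    moreover have "\<mu> \<in> U1 \<inter> U2" "U1 \<inter> U2 \<subseteq> a \<inter> b" using U by auto
    ultimately show ?case by (intro bexI conjI)
  next
    case (UN K)
    then obtain k where "k \<in> K" "\<mu> \<in> k" by auto
    with UN.IH[of k] obtain U where "U \<in> \<B>" "\<mu> \<in> U" "U \<subseteq> k" by auto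
    with \<open>k \<in> K\<close> show ?case by (intro bexI[of _ U]) auto
  next
    case (Basis s)
    then obtain f U where s: "s = {\<mu> \<in> ?P. (\<integral>x. f x \<partial>\<mu>) \<in> U}"
      and f: "f \<in> bounded_cont ?X" and U: "open U" by blast
    then have \<mu>: "\<mu> \<in> ?P" "(\<integral>x. f x \<partial>\<mu>) \<in> U" using Basis by auto
    obtain e where e: "0 < e" "\<And>y. dist y (\<integral>x. f x \<partial>\<mu>) < e \<Longrightarrow> y \<in> U"
      using U \<mu>(2) unfolding open_dist by blast
    obtain g1 t1 g2 t2 where g: "g1 \<in> G" "t1 \<in> \<rat>" "g2 \<in> G" "t2 \<in> \<rat>" "t1 < (\<integral>x. g1 x \<partial>\<mu>)" "t2 < (\<integral>x. g2 x \<partial>\<mu>)"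
      and *: "\<And>\<nu>. \<nu> \<in> ?P \<Longrightarrow> t1 < (\<integral>x. g1 x \<partial>\<nu>) \<Longrightarrow> t2 < (\<integral>x. g2 x \<partial>\<nu>) \<Longrightarrow>
            \<bar>(\<integral>x. f x \<partial>\<nu>) - (\<integral>x. f x \<partial>\<mu>)\<bar> < e"
      using nbh[rule_format, OF f \<mu>(1) e(1)] by metis
    let ?F = "{{\<nu> \<in> ?P. t1 < (\<integral>x. g1 x \<partial>\<nu>)}, {\<nu> \<in> ?P. t2 < (\<integral>x. g2 x \<partial>\<nu>)}}"
    have "?F \<subseteq> \<S>"
      unfolding \<S>_def using g image_eqI[of _ "\<lambda>(g, t). {\<nu> \<in> ?P. t < (\<integral>x. g x \<partial>\<nu>)}" "(g1, t1)"]
        image_eqI[of _ "\<lambda>(g, t). {\<nu> \<in> ?P. t < (\<integral>x. g x \<partial>\<nu>)}" "(g2, t2)"] by simp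
    then have "?P \<inter> \<Inter>?F \<in> \<B>" unfolding \<B>_def by (intro imageI) auto
    moreover have "\<mu> \<in> ?P \<inter> \<Inter>?F" using \<mu> g by simp
    moreover have "?P \<inter> \<Inter>?F \<subseteq> s" using * e(2) by (auto simp: s dist_real_def)
    ultimately show ?case by (intro bexI conjI)
  qed
  show thesis
  proof (rule that[OF cB])
    show "\<B> \<subseteq> sets (prob_algebra (borel_of ?X))" using B_sets by blast
    fix V \<mu> assume "openin (weak_topology ?X) V" "\<mu> \<in> V"
    then show "\<exists>U \<in> \<B>. \<mu> \<in> U \<and> U \<subseteq> V"
      unfolding weak_topology_def openin_topology_generated_by_iff by (rule base)
  qed
qed

text \<open>An open set is the union of the base members inside it, and the base is countable, so
  the union stays measurable. This is what makes \<open>F (h y)\<close> measurable in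
  \<open>y\<close> for a stochastic kernel \<open>h\<close> and a weakly continuous
  \<open>F\<close>.\<close>

lemma sets_borel_of_weak_topology_subset:
  fixes S :: "'a::{metric_space, second_countable_topology} set"
  shows "sets (borel_of (weak_topology (top_of_set S))) \<subseteq> sets (prob_algebra (borel_of (top_of_set S)))"
proof -
  let ?X = "top_of_set S"
  obtain \<B> where \<B>: "countable \<B>" "\<B> \<subseteq> sets (prob_algebra (borel_of ?X))"
    "\<And>V \<mu>. openin (weak_topology ?X) V \<Longrightarrow> \<mu> \<in> V \<Longrightarrow> \<exists>U \<in> \<B>. \<mu> \<in> U \<and> U \<subseteq> V"
    using weak_topology_countable_base[of S] by blast
  have "V \<in> sets (prob_algebra (borel_of ?X))" if V: "openin (weak_topology ?X) V" for V
  proof -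
    have "V = \<Union>{U \<in> \<B>. U \<subseteq> V}" using \<B>(3)[OF V] by blast
    also have "\<dots> \<in> sets (prob_algebra (borel_of ?X))"
      using \<B>(1,2) by (intro sets.countable_Union) auto
    finally show ?thesis .
  qed
  then show ?thesis
    unfolding sets_borel_of topspace_weak_topology space_prob_algebra_borel_of[symmetric]
    by (intro sets.sigma_sets_subset) auto
qed

lemma measurable_borel_of_weak_topology:
  fixes S :: "'a::{metric_space, second_countable_topology} set"
  assumes "K \<in> M \<rightarrow>\<^sub>M prob_algebra (borel_of (top_of_set S))"
  shows "K \<in> M \<rightarrow>\<^sub>M borel_of (weak_topology (top_of_set S))"
  using assms sets_borel_of_weak_topology_subset[of S]
  by (auto simp: measurable_def space_prob_algebra_borel_of)

subsection \<open>Uniform convergence of integrals\<close>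


text \<open>Passing to the densities \<open>indicator Y\<close> turns the inequality for subsets of
  \<open>Y\<close> into an inequality between measures, and the nonnegative integral is monotone in
  the measure. The bound \<open>C\<close> provides the integrability that carries the result over to
  real integrals.\<close>

lemma integral_mono_measure_on:
  fixes f :: "'a \<Rightarrow> real"
  assumes M: "finite_measure M" and N: "finite_measure N" and sets: "sets N = sets M"
    and Y: "Y \<in> sets M" "\<And>X. X \<in> sets M \<Longrightarrow> X \<subseteq> Y \<Longrightarrow> emeasure N X \<le> emeasure M X"
    and f: "f \<in> borel_measurable M" "\<And>x. x \<in> space M \<Longrightarrow> 0 \<le> f x" "\<And>x. x \<in> space M \<Longrightarrow> f x \<le> C"
  shows "(\<integral>x. indicator Y x * f x \<partial>N) \<le> (\<integral>x. indicator Y x * f x \<partial>M)"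
proof -
  interpret M: finite_measure M by fact
  interpret N: finite_measure N by fact
  have sp: "space N = space M" using sets by (rule sets_eq_imp_space_eq)
  have fN: "f \<in> borel_measurable N" using f(1) by (simp add: measurable_cong_sets[OF sets refl])
  have YN: "Y \<in> sets N" using Y sets by simp
  have "emeasure (density N (indicator Y)) X \<le> emeasure (density M (indicator Y)) X" for X
  proof (cases "X \<in> sets M")
    case True
    then have "emeasure N (Y \<inter> X) \<le> emeasure M (Y \<inter> X)" using Y by (intro Y(2)) auto
    then show ?thesis
      using True Y(1) YN sets by (simp add: emeasure_density nn_integral_indicator flip: indicator_inter_arith)
  qed (simp add: emeasure_notin_sets sets)
  then have "density N (indicator Y) \<le> density M (indicator Y)"
    using sets sp by (simp add: le_measure_iff le_fun_def)
  then have "(\<integral>\<^sup>+x. f x \<partial>density N (indicator Y)) \<le> (\<integral>\<^sup>+x. f x \<partial>density M (indicator Y))"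
    using sets by (intro nn_integral_mono_measure) auto
  then have *: "(\<integral>\<^sup>+x. indicator Y x * ennreal (f x) \<partial>N) \<le> (\<integral>\<^sup>+x. indicator Y x * ennreal (f x) \<partial>M)"
    using f(1) fN Y(1) YN by (simp add: nn_integral_density)
  have eq: "indicator Y x * ennreal (f x) = ennreal (indicator Y x * f x)" for x
    by (simp add: indicator_def)
  have int: "integrable M (\<lambda>x. indicator Y x * f x)"
    using f Y(1) by (intro M.integrable_abs_bounded[of _ C]) (auto simp: indicator_def intro: order_trans)
  have intN: "integrable N (\<lambda>x. indicator Y x * f x)"
    using f fN YN sp by (intro N.integrable_abs_bounded[of _ C]) (auto simp: indicator_def intro: order_trans)
  have nM: "0 \<le> (\<integral>x. indicator Y x * f x \<partial>M)"
    using f(2) by (intro Bochner_Integration.integral_nonneg_AE) (auto simp: indicator_def)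
  have "ennreal (\<integral>x. indicator Y x * f x \<partial>N) \<le> ennreal (\<integral>x. indicator Y x * f x \<partial>M)"
  proof -
    have "AE x in M. 0 \<le> indicator Y x * f x" "AE x in N. 0 \<le> indicator Y x * f x"
      using f(2) sp by (auto simp: indicator_def)
    then show ?thesis
      using * by (simp only: eq nn_integral_eq_integral[OF int] nn_integral_eq_integral[OF intN])
  qed
  then show ?thesis using nM by (simp add: ennreal_le_iff)
qed

text \<open>Take a Hahn decomposition into \<open>Y\<close>, where \<open>M\<close> dominates, and
  \<open>Z\<close>, where \<open>N\<close> dominates. On \<open>Z\<close> the integral against
  \<open>N\<close> is the larger one. On \<open>Y\<close>, comparing the integrals of
  \<open>1 - f\<close> bounds the excess of \<open>M\<close> by
  \<open>measure M Y - measure N Y\<close>, so closeness is used for the single set \<open>Y\<close>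
  and the error is exactly \<open>e\<close>.\<close>

lemma integral_le_add_of_setwise_close:
  fixes f :: "'a \<Rightarrow> real"
  assumes M: "prob_space M" and N: "prob_space N" and sets: "sets N = sets M"
    and close: "\<And>B. B \<in> sets M \<Longrightarrow> \<bar>measure M B - measure N B\<bar> \<le> e"
    and f: "f \<in> borel_measurable M" "\<And>x. x \<in> space M \<Longrightarrow> 0 \<le> f x" "\<And>x. x \<in> space M \<Longrightarrow> f x \<le> 1"
  shows "(\<integral>x. f x \<partial>M) \<le> (\<integral>x. f x \<partial>N) + e"
proof -
  interpret M: prob_space M by fact
  interpret N: prob_space N by fact
  have sp: "space N = space M" using sets by (rule sets_eq_imp_space_eq)
  have fN: "f \<in> borel_measurable N" using f(1) by (simp add: measurable_cong_sets[OF sets refl])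
  obtain Y where Y: "Y \<in> sets M" and *: "\<forall>X\<in>sets M. X \<subseteq> Y \<longrightarrow> emeasure N X \<le> emeasure M X"
    "\<forall>X\<in>sets M. X \<inter> Y = {} \<longrightarrow> emeasure M X \<le> emeasure N X"
    using finite_unsigned_Hahn_decomposition[OF M.finite_measure_axioms N.finite_measure_axioms sets] by blast
  define Z where "Z = space M - Y"
  have Z: "Z \<in> sets M" using Y by (simp add: Z_def)
  have intM: "integrable M g" if "g \<in> borel_measurable M" "\<And>x. x \<in> space M \<Longrightarrow> 0 \<le> g x \<and> g x \<le> 1" for g :: "'a \<Rightarrow> real"
    using that by (intro M.integrable_abs_bounded[of _ 1]) auto
  have intN: "integrable N g" if "g \<in> borel_measurable M" "\<And>x. x \<in> space M \<Longrightarrow> 0 \<le> g x \<and> g x \<le> 1" for g :: "'a \<Rightarrow> real"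
    using that sp by (intro N.integrable_abs_bounded[of _ 1]) (auto simp: measurable_cong_sets[OF sets refl])
  have ind: "0 \<le> indicator A x * f x \<and> indicator A x * f x \<le> 1" if "x \<in> space M" for A x
    using f(2,3)[OF that] by (auto simp: indicator_def)
  have ind1: "0 \<le> indicator A x * (1 - f x) \<and> indicator A x * (1 - f x) \<le> 1" if "x \<in> space M" for A x
    using f(2,3)[OF that] by (auto simp: indicator_def)
  have m [measurable]: "(\<lambda>x. indicator A x * f x) \<in> borel_measurable M" if [measurable]: "A \<in> sets M" for A
    using f(1) by measurable
  have m1 [measurable]: "(\<lambda>x. indicator A x * (1 - f x)) \<in> borel_measurable M" if [measurable]: "A \<in> sets M" for A
    using f(1) by measurable
  have split: "f x = indicator Y x * f x + indicator Z x * f x" if "x \<in> space M" for x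
    using that by (auto simp: Z_def indicator_def)
  have "(\<integral>x. indicator Z x * f x \<partial>M) \<le> (\<integral>x. indicator Z x * f x \<partial>N)"
    using Z *(2) f fN sets sp
    by (intro integral_mono_measure_on[where C = 1] M.finite_measure_axioms N.finite_measure_axioms)
       (auto simp: Z_def)
  moreover have "(\<integral>x. indicator Y x * (1 - f x) \<partial>N) \<le> (\<integral>x. indicator Y x * (1 - f x) \<partial>M)"
    using Y *(1) f sets
    by (intro integral_mono_measure_on[where C = 1] M.finite_measure_axioms N.finite_measure_axioms) auto
  moreover have "(\<integral>x. indicator Y x * (1 - f x) \<partial>M) = measure M Y - (\<integral>x. indicator Y x * f x \<partial>M)"
    using intM[OF m[OF Y] ind] intM[of "indicator Y"] Y by (simp add: right_diff_distrib)
  moreover have "(\<integral>x. indicator Y x * (1 - f x) \<partial>N) = measure N Y - (\<integral>x. indicator Y x * f x \<partial>N)"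
    using intN[OF m[OF Y] ind] intN[of "indicator Y"] Y sets by (simp add: right_diff_distrib)
  moreover have "\<bar>measure M Y - measure N Y\<bar> \<le> e" by (rule close[OF Y])
  moreover have "(\<integral>x. f x \<partial>M) = (\<integral>x. indicator Y x * f x \<partial>M) + (\<integral>x. indicator Z x * f x \<partial>M)"
    using intM[OF m[OF Y] ind] intM[OF m[OF Z] ind]
      Bochner_Integration.integral_cong[OF refl split, of M] sp
    by (simp add: Bochner_Integration.integral_add)
  moreover have "(\<integral>x. f x \<partial>N) = (\<integral>x. indicator Y x * f x \<partial>N) + (\<integral>x. indicator Z x * f x \<partial>N)"
    using intN[OF m[OF Y] ind] intN[OF m[OF Z] ind]
      Bochner_Integration.integral_cong[OF refl split, of N] sp
    by (simp add: Bochner_Integration.integral_add)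
  ultimately show ?thesis by linarith
qed

text \<open>The affine map from [-C, C] onto [0, 1] reduces this to the one-sided estimate, used in
  both directions; undoing it produces the factor \<open>2 * C\<close>.\<close>

lemma abs_integral_diff_le_of_setwise_close:
  fixes f :: "'a \<Rightarrow> real"
  assumes M: "prob_space M" and N: "prob_space N" and sets: "sets N = sets M"
    and close: "\<And>B. B \<in> sets M \<Longrightarrow> \<bar>measure M B - measure N B\<bar> \<le> e"
    and f: "f \<in> borel_measurable M" "\<And>x. x \<in> space M \<Longrightarrow> \<bar>f x\<bar> \<le> C" and C: "0 < C"
  shows "\<bar>(\<integral>x. f x \<partial>M) - (\<integral>x. f x \<partial>N)\<bar> \<le> 2 * C * e"
proof -
  interpret M: prob_space M by fact
  interpret N: prob_space N by fact
  have sp: "space N = space M" using sets by (rule sets_eq_imp_space_eq)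
  have fN: "f \<in> borel_measurable N" using f(1) by (simp add: measurable_cong_sets[OF sets refl])
  define g where "g x = (f x + C) / (2 * C)" for x
  have g: "g \<in> borel_measurable M" "g \<in> borel_measurable N" using f(1) fN by (auto simp: g_def[abs_def])
  have gb: "0 \<le> g x \<and> g x \<le> 1" if "x \<in> space M" for x
    using f(2)[OF that] C by (auto simp: g_def field_simps)
  have eM: "(\<integral>x. g x \<partial>M) = ((\<integral>x. f x \<partial>M) + C) / (2 * C)"
    unfolding g_def using M.integrable_abs_bounded[OF f] by (simp add: M.prob_space)
  have eN: "(\<integral>x. g x \<partial>N) = ((\<integral>x. f x \<partial>N) + C) / (2 * C)"
    unfolding g_def using N.integrable_abs_bounded[OF fN f(2)] N.prob_space by (simp add: sp)
  have "(\<integral>x. g x \<partial>M) \<le> (\<integral>x. g x \<partial>N) + e"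
    using gb g by (intro integral_le_add_of_setwise_close M N sets close) auto
  moreover have "(\<integral>x. g x \<partial>N) \<le> (\<integral>x. g x \<partial>M) + e"
    using gb g close sets sp by (intro integral_le_add_of_setwise_close M N) (auto simp: abs_minus_commute)
  ultimately have "\<bar>(\<integral>x. g x \<partial>M) - (\<integral>x. g x \<partial>N)\<bar> \<le> e" by linarith
  moreover have "(\<integral>x. g x \<partial>M) - (\<integral>x. g x \<partial>N) = ((\<integral>x. f x \<partial>M) - (\<integral>x. f x \<partial>N)) / (2 * C)"
    unfolding eM eN by (simp add: diff_divide_distrib add_divide_distrib)
  ultimately show ?thesis using C by (simp add: abs_divide field_simps)
qed

text \<open>Pointwise, \<open>f\<close> minus the sum of the \<open>p i * u i x\<close> splits into
  the sum of the \<open>u i x * (f x - p i)\<close>, at most \<epsilon>, and \<open>f x\<close>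
  times the part of 1 that the \<open>u i\<close> miss. The approximating sum sees \<open>f\<close>
  only through the sample values \<open>p i\<close>, which is what gives uniformity over families of
  integrands.\<close>

lemma (in prob_space) integral_partition_estimate:
  fixes f :: "'a \<Rightarrow> real" and u :: "nat \<Rightarrow> 'a \<Rightarrow> real"
  assumes f: "f \<in> borel_measurable M" "\<And>x. x \<in> space M \<Longrightarrow> \<bar>f x\<bar> \<le> C"
    and u: "\<And>i. u i \<in> borel_measurable M" "\<And>i x. x \<in> space M \<Longrightarrow> 0 \<le> u i x"
      "\<And>x. x \<in> space M \<Longrightarrow> (\<Sum>i<K. u i x) \<le> 1"
    and p: "\<And>i x. i < K \<Longrightarrow> x \<in> space M \<Longrightarrow> u i x \<noteq> 0 \<Longrightarrow> \<bar>f x - p i\<bar> \<le> \<epsilon>"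
    and \<epsilon>: "0 \<le> \<epsilon>"
  shows "\<bar>(\<integral>x. f x \<partial>M) - (\<Sum>i<K. p i * (\<integral>x. u i x \<partial>M))\<bar> \<le> \<epsilon> + C * (1 - (\<Sum>i<K. \<integral>x. u i x \<partial>M))"
proof -
  have intf: "integrable M f" by (rule integrable_abs_bounded[OF f])
  have intu: "integrable M (u i)" if "i < K" for i
  proof (rule integrable_abs_bounded[OF u(1)])
    fix x assume x: "x \<in> space M"
    have "u i x \<le> (\<Sum>i<K. u i x)" using that u(2)[OF x] by (intro member_le_sum) auto
    then show "\<bar>u i x\<bar> \<le> 1" using u(2,3)[OF x] by (simp add: order_trans)
  qed
  have intpu: "integrable M (\<lambda>x. \<Sum>i<K. p i * u i x)" and intsu: "integrable M (\<lambda>x. \<Sum>i<K. u i x)"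
    by (intro Bochner_Integration.integrable_sum integrable_mult_right intu; simp)+
  have eqpu: "(\<integral>x. (\<Sum>i<K. p i * u i x) \<partial>M) = (\<Sum>i<K. p i * (\<integral>x. u i x \<partial>M))"
    by (subst Bochner_Integration.integral_sum) (auto intro: intu)
  have equ: "(\<integral>x. (\<Sum>i<K. u i x) \<partial>M) = (\<Sum>i<K. \<integral>x. u i x \<partial>M)"
    by (rule Bochner_Integration.integral_sum) (auto intro: intu)
  let ?g = "\<lambda>x. f x - (\<Sum>i<K. p i * u i x)"
  let ?h = "\<lambda>x. \<epsilon> + C * (1 - (\<Sum>i<K. u i x))"
  have intg: "integrable M ?g" by (rule Bochner_Integration.integrable_diff[OF intf intpu])
  have pw: "\<bar>?g x\<bar> \<le> ?h x" if x: "x \<in> space M" for x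
  proof -
    have "(\<Sum>i<K. u i x * (f x - p i)) = (\<Sum>i<K. f x * u i x - p i * u i x)"
      by (intro sum.cong refl) (simp add: algebra_simps)
    also have "\<dots> = f x * (\<Sum>i<K. u i x) - (\<Sum>i<K. p i * u i x)"
      by (simp only: sum_subtractf sum_distrib_left)
    finally have "?g x = (\<Sum>i<K. u i x * (f x - p i)) + f x * (1 - (\<Sum>i<K. u i x))"
      by (simp add: right_diff_distrib)
    then have "\<bar>?g x\<bar> \<le> (\<Sum>i<K. \<bar>u i x * (f x - p i)\<bar>) + \<bar>f x * (1 - (\<Sum>i<K. u i x))\<bar>"
      using abs_triangle_ineq[of "\<Sum>i<K. u i x * (f x - p i)" "f x * (1 - (\<Sum>i<K. u i x))"]
        sum_abs[of "\<lambda>i. u i x * (f x - p i)" "{..<K}"] by linarith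
    also have "\<dots> \<le> (\<Sum>i<K. u i x * \<epsilon>) + C * (1 - (\<Sum>i<K. u i x))"
    proof (intro add_mono sum_mono)
      fix i assume "i \<in> {..<K}"
      then show "\<bar>u i x * (f x - p i)\<bar> \<le> u i x * \<epsilon>"
        using p[of i x] u(2)[OF x, of i] x by (cases "u i x = 0") (auto simp: abs_mult)
    next
      show "\<bar>f x * (1 - (\<Sum>i<K. u i x))\<bar> \<le> C * (1 - (\<Sum>i<K. u i x))"
        using f(2)[OF x] u(3)[OF x] by (auto simp: abs_mult intro!: mult_right_mono)
    qed
    also have "(\<Sum>i<K. u i x * \<epsilon>) \<le> 1 * \<epsilon>"
      unfolding sum_distrib_right[symmetric] using u(3)[OF x] \<epsilon> by (rule mult_right_mono)
    finally show ?thesis by simp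
  qed
  have "(\<integral>x. f x \<partial>M) - (\<Sum>i<K. p i * (\<integral>x. u i x \<partial>M)) = (\<integral>x. ?g x \<partial>M)"
    unfolding eqpu[symmetric] by (rule Bochner_Integration.integral_diff[OF intf intpu, symmetric])
  moreover have "\<bar>\<integral>x. ?g x \<partial>M\<bar> \<le> (\<integral>x. \<bar>?g x\<bar> \<partial>M)" by (rule integral_abs_bound)
  moreover have "(\<integral>x. \<bar>?g x\<bar> \<partial>M) \<le> (\<integral>x. ?h x \<partial>M)"
  proof (rule integral_mono)
    show "integrable M (\<lambda>x. \<bar>?g x\<bar>)" using intg by (rule integrable_abs)
    show "integrable M ?h" using intsu by simp
  qed (rule pw)
  moreover have "(\<integral>x. ?h x \<partial>M) = \<epsilon> + C * (1 - (\<Sum>i<K. \<integral>x. u i x \<partial>M))"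
    using intsu by (simp add: prob_space equ)
  ultimately show ?thesis by linarith
qed


text \<open>Near each \<open>w\<close>, all \<open>\<phi> n b\<close> with large \<open>n\<close>
  and all \<open>\<psi> b\<close> are within \<epsilon> of the number \<open>\<psi> b w\<close>, for
  every \<open>b\<close> at once. A partition of unity subordinate to such balls reduces the
  integrals to finitely many \<integral>u dz, whose convergence is weak convergence. The index
  \<open>b\<close> enters only through coefficients bounded by \<open>C\<close>, hence the
  uniformity.\<close>

lemma weak_convergence_equicontinuous_family:
  fixes S :: "'a::{metric_space, second_countable_topology} set"
    and \<phi> :: "nat \<Rightarrow> 'i \<Rightarrow> 'a \<Rightarrow> real"
  assumes z: "z0 \<in> prob_measures (top_of_set S)" "\<And>n. z n \<in> prob_measures (top_of_set S)"
      "limitin (weak_topology (top_of_set S)) z z0 sequentially"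
    and \<phi>: "\<And>n b. b \<in> I \<Longrightarrow> \<phi> n b \<in> borel_measurable (borel_of (top_of_set S))"
      "\<And>n b v. b \<in> I \<Longrightarrow> v \<in> S \<Longrightarrow> \<bar>\<phi> n b v\<bar> \<le> C"
    and \<psi>: "\<And>b. b \<in> I \<Longrightarrow> \<psi> b \<in> borel_measurable (borel_of (top_of_set S))"
      "\<And>b v. b \<in> I \<Longrightarrow> v \<in> S \<Longrightarrow> \<bar>\<psi> b v\<bar> \<le> C"
    and equi: "\<And>w e. w \<in> S \<Longrightarrow> 0 < e \<Longrightarrow>
        \<exists>r>0. \<forall>\<^sub>F n in sequentially. \<forall>v \<in> S \<inter> ball w r. \<forall>b \<in> I. \<bar>\<phi> n b v - \<psi> b w\<bar> \<le> e"
    and equi': "\<And>w e. w \<in> S \<Longrightarrow> 0 < e \<Longrightarrow>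
        \<exists>r>0. \<forall>v \<in> S \<inter> ball w r. \<forall>b \<in> I. \<bar>\<psi> b v - \<psi> b w\<bar> \<le> e"
    and C: "0 < C" and e: "0 < e"
  shows "\<forall>\<^sub>F n in sequentially. \<forall>b \<in> I. \<bar>(\<integral>x. \<phi> n b x \<partial>z n) - (\<integral>x. \<psi> b x \<partial>z0)\<bar> \<le> e"
proof -
  let ?X = "top_of_set S"
  \<comment> \<open>The partition misses mass less than \<epsilon> under \<open>z0\<close>, hence at
    most \<open>2 * \<epsilon>\<close> under \<open>z n\<close>. Approximation thus costs
    \<open>\<epsilon> + C * \<epsilon>\<close> at \<open>z0\<close> and
    \<open>\<epsilon> + 2 * C * \<epsilon>\<close> at \<open>z n\<close>; exchanging the integrals
    of the partition functions costs another \<open>C * \<epsilon>\<close>. The total is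
    \<open>(2 + 4 * C) * \<epsilon> = e\<close>.\<close>
  define \<epsilon> where "\<epsilon> = e / (2 + 4 * C)"
  have \<epsilon>: "0 < \<epsilon>" using e C by (simp add: \<epsilon>_def)
  have sp: "space \<nu> = S" if "\<nu> \<in> prob_measures ?X" for \<nu> using prob_measuresD(3)[OF that] by simp
  define Q where "Q w r \<longleftrightarrow> 0 < r \<and>
      (\<forall>\<^sub>F n in sequentially. \<forall>v \<in> S \<inter> ball w r. \<forall>b \<in> I. \<bar>\<phi> n b v - \<psi> b w\<bar> \<le> \<epsilon>) \<and>
      (\<forall>v \<in> S \<inter> ball w r. \<forall>b \<in> I. \<bar>\<psi> b v - \<psi> b w\<bar> \<le> \<epsilon>)" for w r
  have "\<exists>r. Q w r" if w: "w \<in> S" for w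
  proof -
    obtain r1 where 1: "0 < r1"
      "\<forall>\<^sub>F n in sequentially. \<forall>v \<in> S \<inter> ball w r1. \<forall>b \<in> I. \<bar>\<phi> n b v - \<psi> b w\<bar> \<le> \<epsilon>"
      using equi[OF w \<epsilon>] by (elim exE conjE)
    obtain r2 where 2: "0 < r2" "\<forall>v \<in> S \<inter> ball w r2. \<forall>b \<in> I. \<bar>\<psi> b v - \<psi> b w\<bar> \<le> \<epsilon>"
      using equi'[OF w \<epsilon>] by (elim exE conjE)
    have "\<forall>\<^sub>F n in sequentially. \<forall>v \<in> S \<inter> ball w (min r1 r2). \<forall>b \<in> I. \<bar>\<phi> n b v - \<psi> b w\<bar> \<le> \<epsilon>"
      using 1(2) by eventually_elim auto
    then have "Q w (min r1 r2)" using 1(1) 2 by (auto simp: Q_def)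
    then show ?thesis by blast
  qed
  then obtain r where Q: "\<And>w. w \<in> S \<Longrightarrow> Q w (r w)" by metis
  have r: "\<And>w. w \<in> S \<Longrightarrow> 0 < r w"
    "\<And>w. w \<in> S \<Longrightarrow> \<forall>\<^sub>F n in sequentially. \<forall>v \<in> S \<inter> ball w (r w). \<forall>b \<in> I. \<bar>\<phi> n b v - \<psi> b w\<bar> \<le> \<epsilon>"
    "\<And>w v b. w \<in> S \<Longrightarrow> v \<in> S \<inter> ball w (r w) \<Longrightarrow> b \<in> I \<Longrightarrow> \<bar>\<psi> b v - \<psi> b w\<bar> \<le> \<epsilon>"
    using Q unfolding Q_def by blast+
  obtain \<F> where \<F>: "\<F> \<subseteq> (\<lambda>w. ball w (r w)) ` S" "countable \<F>" "\<Union>\<F> = (\<Union>w\<in>S. ball w (r w))"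
  proof (rule Lindelof)
    show "open B" if "B \<in> (\<lambda>w. ball w (r w)) ` S" for B using that by auto
  qed (rule that)
  have "countable \<F> \<and> \<F> \<subseteq> (\<lambda>w. ball w (r w)) ` S" using \<F>(1,2) by simp
  then obtain T where T: "countable T" "T \<subseteq> S" "\<F> = (\<lambda>w. ball w (r w)) ` T"
    unfolding countable_subset_image by (elim exE conjE)
  have cover: "\<exists>w \<in> T. dist v w < r w" if "v \<in> S" for v
  proof -
    have "v \<in> \<Union>\<F>" using that r(1) unfolding \<F>(3) by force
    then show ?thesis unfolding T(3) by (auto simp: dist_commute)
  qed
  have "S \<noteq> {}" using sp[OF z(1)] prob_space.not_empty[OF prob_measuresD(1)[OF z(1)]] by simp
  then have Tne: "T \<noteq> {}" using cover by blast
  define c where "c = from_nat_into T"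
  have cS: "c i \<in> S" for i using from_nat_into[OF Tne] T(2) by (auto simp: c_def)
  \<comment> \<open>A partition of unity subordinate to the balls, up to a \<open>z0\<close>-small error; bounding the denominator
    below by \<open>1 / (K + 1)\<close> keeps it continuous where all \<open>h i\<close> with \<open>i < K\<close> vanish.\<close>
  define h where "h i v = max 0 (r (c i) - dist v (c i))" for i v
  define s where "s K v = (\<Sum>i<K. h i v)" for K v
  define m where "m K v = max (1 / real (Suc K)) (s K v)" for K v
  define u where "u K i v = h i v / m K v" for K i v
  have h0: "0 \<le> h i v" for i v by (simp add: h_def)
  have s0: "0 \<le> s K v" for K v by (simp add: s_def h0 sum_nonneg)
  have m0: "0 < m K v" for K v by (simp add: m_def less_max_iff_disj)
  have u0: "0 \<le> u K i v" for K i v using h0 m0[of K v] by (simp add: u_def less_imp_le)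
  have sum_u: "(\<Sum>i<K. u K i v) = s K v / m K v" for K v by (simp add: u_def s_def sum_divide_distrib)
  have sum_u1: "(\<Sum>i<K. u K i v) \<le> 1" for K v using m0[of K v] by (simp add: sum_u) (simp add: m_def)
  have u_ball: "v \<in> ball (c i) (r (c i))" if "u K i v \<noteq> 0" for K i v
    using that by (auto simp: u_def h_def dist_commute max_def split: if_splits)
  have h_cont: "continuous_on S (h i)" for i
    unfolding h_def[abs_def] by (intro continuous_intros)
  have u_cont: "continuous_on S (u K i)" for K i
  proof -
    have "continuous_on S (s K)"
      unfolding s_def[abs_def] by (intro continuous_on_sum h_cont)
    then have "continuous_on S (m K)"
      unfolding m_def[abs_def] by (intro continuous_intros)
    then show ?thesis
      unfolding u_def[abs_def] by (intro continuous_on_divide h_cont) (simp_all add: m0 less_imp_neq[OF m0, symmetric])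
  qed
  have u_bd: "u K i v \<le> 1" if "i < K" for K i v
  proof -
    have "u K i v \<le> (\<Sum>i<K. u K i v)" using that u0 by (intro member_le_sum) auto
    then show ?thesis using sum_u1 order_trans by blast
  qed
  have u_bc: "u K i \<in> bounded_cont ?X" if "i < K" for K i
    using u_cont u0 u_bd[OF that] by (auto simp: bounded_cont_top_of_set intro!: boundedI[of _ 1])
  \<comment> \<open>\<open>integral_partition_estimate\<close> asks for measurability at every
    index, whereas \<open>u_bc\<close> speaks of \<open>i < K\<close> only.\<close>
  have u_meas: "u K i \<in> borel_measurable \<nu>" if "\<nu> \<in> prob_measures ?X" for K i \<nu>
  proof -
    have "continuous_map ?X euclideanreal (u K i)" using u_cont by simp
    from borel_of_measurable_continuous[OF this]
    have "u K i \<in> borel_of ?X \<rightarrow>\<^sub>M borel"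
      using measurable_cong_sets[of "borel_of ?X" "borel_of ?X" "borel_of euclideanreal" "borel :: real measure"]
      by (simp add: sets_borel_of borel_def)
    then show ?thesis using measurable_cong_sets[OF prob_measuresD(2)[OF that] refl] by blast
  qed
  have "(\<lambda>K. \<integral>v. (\<Sum>i<K. u K i v) \<partial>z0) \<longlonglongrightarrow> (\<integral>v. 1 \<partial>z0)"
  proof (rule integral_dominated_convergence[where w = "\<lambda>_. 1"])
    interpret prob_space z0 by (rule prob_measuresD(1)[OF z(1)])
    show "integrable z0 (\<lambda>_. 1 :: real)" by simp
    show "(\<lambda>v. \<Sum>i<K. u K i v) \<in> borel_measurable z0" for K
      using u_meas[OF z(1)] by (intro borel_measurable_sum)
    show "AE v in z0. norm (\<Sum>i<K. u K i v) \<le> 1" for K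
      using sum_u1 by (auto simp: abs_of_nonneg sum_nonneg u0)
    show "AE v in z0. (\<lambda>K. \<Sum>i<K. u K i v) \<longlonglongrightarrow> 1"
    proof (rule AE_I2)
      fix v assume "v \<in> space z0"
      then obtain w where w: "w \<in> T" "dist v w < r w" using cover sp[OF z(1)] by auto
      then obtain i where i: "w = c i" using from_nat_into_surj[OF T(1) w(1)] by (auto simp: c_def)
      have hi: "0 < h i v" using w by (simp add: h_def i)
      obtain N where N: "1 / real (Suc N) < h i v" using nat_approx_posE[OF hi] by blast
      \<comment> \<open>Once the ball around \<open>c i\<close> is among the first \<open>K\<close>
        and \<open>1 / (K + 1)\<close> is below \<open>h i v\<close>, the maximum in
        \<open>m K v\<close> is attained by \<open>s K v\<close> and the normalisation is exact at
        \<open>v\<close>.\<close>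
      have "(\<Sum>i<K. u K i v) = 1" if K: "K > max i N" for K
      proof -
        have "1 / real (Suc K) \<le> 1 / real (Suc N)" using K by (simp add: frac_le)
        also have "\<dots> \<le> h i v" using N by simp
        also have "\<dots> \<le> s K v" unfolding s_def using K h0 by (intro member_le_sum) auto
        finally have "m K v = s K v" by (simp add: m_def)
        then show ?thesis using m0[of K v] by (simp add: sum_u)
      qed
      then have "\<forall>\<^sub>F K in sequentially. (\<Sum>i<K. u K i v) = 1"
        unfolding eventually_at_top_dense by (intro exI[of _ "max i N"] allI impI)
      then show "(\<lambda>K. \<Sum>i<K. u K i v) \<longlonglongrightarrow> 1" by (rule tendsto_eventually)
    qed
  qed simp_all
  moreover have "(\<integral>v. 1 \<partial>z0) = (1 :: real)"
    using prob_space.prob_space[OF prob_measuresD(1)[OF z(1)]] by simp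
  ultimately have "\<forall>\<^sub>F K in sequentially. 1 - \<epsilon> < (\<integral>v. (\<Sum>i<K. u K i v) \<partial>z0)"
    using \<epsilon> by (intro order_tendstoD(1)) auto
  then obtain K where "1 - \<epsilon> < (\<integral>v. (\<Sum>i<K. u K i v) \<partial>z0)" by (auto simp: eventually_sequentially)
  moreover have "(\<integral>v. (\<Sum>i<K. u K i v) \<partial>z0) = (\<Sum>i<K. \<integral>v. u K i v \<partial>z0)"
    using integrable_bounded_cont[OF u_bc z(1)] by (intro Bochner_Integration.integral_sum) auto
  ultimately have K: "1 - \<epsilon> < (\<Sum>i<K. \<integral>v. u K i v \<partial>z0)" by simp
  have lim: "(\<lambda>n. \<integral>v. u K i v \<partial>z n) \<longlonglongrightarrow> (\<integral>v. u K i v \<partial>z0)" if "i < K" for i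
    using z(3) u_bc[OF that] by (simp add: limitin_weak_topology)
  have "\<forall>\<^sub>F n in sequentially. (\<Sum>i<K. \<bar>(\<integral>v. u K i v \<partial>z n) - (\<integral>v. u K i v \<partial>z0)\<bar>) < \<epsilon>"
  proof (rule order_tendstoD(2)[OF _ \<epsilon>])
    have "(\<lambda>n. \<Sum>i<K. \<bar>(\<integral>v. u K i v \<partial>z n) - (\<integral>v. u K i v \<partial>z0)\<bar>) \<longlonglongrightarrow> (\<Sum>i<K. 0)"
      using lim by (intro tendsto_sum tendsto_rabs_zero LIM_zero) auto
    then show "(\<lambda>n. \<Sum>i<K. \<bar>(\<integral>v. u K i v \<partial>z n) - (\<integral>v. u K i v \<partial>z0)\<bar>) \<longlonglongrightarrow> 0" by simp
  qed
  \<comment> \<open>After truncation at \<open>K\<close> only finitely many balls remain, so their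
    eventual estimates hold simultaneously.\<close>
  moreover have "\<forall>\<^sub>F n in sequentially. \<forall>i \<in> {..<K}. \<forall>v \<in> S \<inter> ball (c i) (r (c i)). \<forall>b \<in> I. \<bar>\<phi> n b v - \<psi> b (c i)\<bar> \<le> \<epsilon>"
    using r(2)[OF cS] by (intro eventually_ball_finite) auto
  ultimately show ?thesis
  proof eventually_elim
    case (elim n)
    show ?case
    proof
      fix b assume b: "b \<in> I"
      define a where "a i = (\<integral>v. u K i v \<partial>z n)" for i
      define a0 where "a0 i = (\<integral>v. u K i v \<partial>z0)" for i
      have d: "(\<Sum>i<K. \<bar>a i - a0 i\<bar>) < \<epsilon>" using elim(1) by (simp add: a_def a0_def)
      have K0: "1 - \<epsilon> < (\<Sum>i<K. a0 i)" using K by (simp add: a0_def)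
      \<comment> \<open>The same sample values \<open>\<psi> b (c i)\<close> serve for
        \<open>\<phi> n b\<close> under \<open>z n\<close> and for \<open>\<psi> b\<close> under
        \<open>z0\<close>, so that afterwards only the integrals of the \<open>u K i\<close> have to
        be compared.\<close>
      have est: "\<bar>(\<integral>x. g x \<partial>\<nu>) - (\<Sum>i<K. \<psi> b (c i) * (\<integral>v. u K i v \<partial>\<nu>))\<bar> \<le> \<epsilon> + C * (1 - (\<Sum>i<K. \<integral>v. u K i v \<partial>\<nu>))"
        if \<nu>: "\<nu> \<in> prob_measures ?X" and g: "g \<in> borel_measurable (borel_of ?X)" "\<And>v. v \<in> S \<Longrightarrow> \<bar>g v\<bar> \<le> C"
          and gp: "\<And>i v. i < K \<Longrightarrow> v \<in> S \<inter> ball (c i) (r (c i)) \<Longrightarrow> \<bar>g v - \<psi> b (c i)\<bar> \<le> \<epsilon>" for \<nu> g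
      proof -
        interpret prob_space \<nu> by (rule prob_measuresD(1)[OF \<nu>])
        show ?thesis
          using g u_meas[OF \<nu>] u0 sum_u1 gp u_ball \<epsilon> sp[OF \<nu>]
          by (intro integral_partition_estimate)
             (auto simp: measurable_cong_sets[OF prob_measuresD(2)[OF \<nu>] refl] simp del: mem_ball)
      qed
      have 1: "\<bar>(\<integral>x. \<phi> n b x \<partial>z n) - (\<Sum>i<K. \<psi> b (c i) * a i)\<bar> \<le> \<epsilon> + C * (1 - (\<Sum>i<K. a i))"
        unfolding a_def using elim(2) b by (intro est z(2) \<phi>) auto
      have 2: "\<bar>(\<integral>x. \<psi> b x \<partial>z0) - (\<Sum>i<K. \<psi> b (c i) * a0 i)\<bar> \<le> \<epsilon> + C * (1 - (\<Sum>i<K. a0 i))"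
        unfolding a0_def using b by (intro est z(1) \<psi> r(3) cS)
      have "\<bar>(\<Sum>i<K. \<psi> b (c i) * a i) - (\<Sum>i<K. \<psi> b (c i) * a0 i)\<bar> = \<bar>\<Sum>i<K. \<psi> b (c i) * (a i - a0 i)\<bar>"
        by (simp add: sum_subtractf right_diff_distrib)
      also have "\<dots> \<le> (\<Sum>i<K. \<bar>\<psi> b (c i) * (a i - a0 i)\<bar>)" by (rule sum_abs)
      also have "\<dots> \<le> (\<Sum>i<K. C * \<bar>a i - a0 i\<bar>)"
        using \<psi>(2)[OF b cS] by (intro sum_mono) (auto simp: abs_mult intro: mult_right_mono)
      also have "\<dots> \<le> C * \<epsilon>"
        unfolding sum_distrib_left[symmetric] using d C by (intro mult_left_mono) auto
      finally have 3: "\<bar>(\<Sum>i<K. \<psi> b (c i) * a i) - (\<Sum>i<K. \<psi> b (c i) * a0 i)\<bar> \<le> C * \<epsilon>" .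
      have "(\<Sum>i<K. a0 i) - (\<Sum>i<K. a i) \<le> (\<Sum>i<K. \<bar>a i - a0 i\<bar>)"
        unfolding sum_subtractf[symmetric] by (intro sum_mono) auto
      then have "1 - (\<Sum>i<K. a i) \<le> 2 * \<epsilon>" using d K0 by linarith
      then have 4: "C * (1 - (\<Sum>i<K. a i)) \<le> C * (2 * \<epsilon>)" using C by (intro mult_left_mono) auto
      have 5: "C * (1 - (\<Sum>i<K. a0 i)) \<le> C * \<epsilon>" using C K0 by (intro mult_left_mono) auto
      have "\<epsilon> * (2 + 4 * C) = e" using C by (simp add: \<epsilon>_def)
      then have "2 * \<epsilon> + 4 * (C * \<epsilon>) = e" by (simp add: algebra_simps)
      then show "\<bar>(\<integral>x. \<phi> n b x \<partial>z n) - (\<integral>x. \<psi> b x \<partial>z0)\<bar> \<le> e"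
        using 1 2 3 4 5 by linarith
    qed
  qed
qed

subsection \<open>Disintegration of slices\<close>


lemma space_fst_slice [simp]: "space (fst_slice X1 \<mu> B) = topspace X1"
  using sets_eq_imp_space_eq[OF sets_fst_slice, of X1 \<mu> B] by simp

lemma kernel_section_measurable:
  assumes P: "stochastic_kernel X (prod_topology XW (prod_topology XY XA)) P"
    and ya: "y \<in> topspace XY" "a \<in> topspace XA"
  shows "(\<lambda>w. P (w, y, a)) \<in> borel_of XW \<rightarrow>\<^sub>M prob_algebra (borel_of X)"
proof -
  have "(\<lambda>w. (w, y, a)) \<in> borel_of XW \<rightarrow>\<^sub>M borel_of (prod_topology XW (prod_topology XY XA))"
    using ya by (intro borel_of_measurable_continuous) (simp add: continuous_map_pairedI)
  from measurable_compose[OF this P[unfolded stochastic_kernel_iff]] show ?thesis .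
qed

lemma fst_slice_kernel_measurable:
  assumes K: "K \<in> M \<rightarrow>\<^sub>M prob_algebra (borel_of (prod_topology X1 X2))" and B: "B \<in> sets (borel_of X2)"
  shows "(\<lambda>w. fst_slice X1 (K w) B) \<in> M \<rightarrow>\<^sub>M subprob_algebra (borel_of X1)"
proof (rule measurable_subprob_algebra)
  fix w assume w: "w \<in> space M"
  then have "K w \<in> prob_measures (prod_topology X1 X2)"
    using measurable_space[OF K] by (simp add: space_prob_algebra_borel_of)
  then show "subprob_space (fst_slice X1 (K w) B)" using B by (rule subprob_space_fst_slice)
next
  fix E assume E: "E \<in> sets (borel_of X1)"
  have "(\<lambda>w. emeasure (K w) (E \<times> B)) \<in> borel_measurable M"
    using times_in_borel_of_prod[OF E B] measurable_emeasure_kernel[OF measurable_prob_algebraD[OF K]] by simp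
  moreover have "emeasure (fst_slice X1 (K w) B) E = emeasure (K w) (E \<times> B)" if "w \<in> space M" for w
    using measurable_space[OF K that] E B
    by (intro emeasure_fst_slice) (auto simp: space_prob_algebra_borel_of dest: prob_measuresD)
  ultimately show "(\<lambda>w. emeasure (fst_slice X1 (K w) B) E) \<in> borel_measurable M"
    by (simp cong: measurable_cong)
qed simp

lemma joint_kernel_prob_measures:
  assumes P: "stochastic_kernel (prod_topology XW XY) (prod_topology XW (prod_topology XY XA)) P"
    and z: "z \<in> prob_measures XW" and ya: "y \<in> topspace XY" "a \<in> topspace XA"
  shows "joint_kernel P (z, y, a) \<in> prob_measures (prod_topology XW XY)"
proof -
  interpret z: prob_space z by (rule prob_measuresD(1)[OF z])
  have K: "(\<lambda>w. P (w, y, a)) \<in> z \<rightarrow>\<^sub>M prob_algebra (borel_of (prod_topology XW XY))"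
    using kernel_section_measurable[OF P ya] by (simp add: measurable_cong_sets[OF prob_measuresD(2)[OF z] refl])
  have "prob_space (z \<bind> (\<lambda>w. P (w, y, a)))"
    using measurable_space[OF K]
    by (intro z.prob_space_bind[OF _ measurable_prob_algebraD[OF K]]) (auto simp: space_prob_algebra)
  moreover have "sets (z \<bind> (\<lambda>w. P (w, y, a))) = sets (borel_of (prod_topology XW XY))"
    using sets_kernel[OF measurable_prob_algebraD[OF K]] z.not_empty by (intro sets_bind) auto
  ultimately show ?thesis by (simp add: joint_kernel_def prob_measures_def)
qed

lemma joint_kernel_return:
  assumes P: "stochastic_kernel (prod_topology XW XY) (prod_topology XW (prod_topology XY XA)) P"
    and w: "w \<in> topspace XW" and ya: "y \<in> topspace XY" "a \<in> topspace XA"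
  shows "joint_kernel P (return (borel_of XW) w, y, a) = P (w, y, a)"
  using bind_return[OF measurable_prob_algebraD[OF kernel_section_measurable[OF P ya]], of w] w
  by (simp add: joint_kernel_def)

lemma return_in_prob_measures: "w \<in> topspace X \<Longrightarrow> return (borel_of X) w \<in> prob_measures X"
  by (simp add: prob_measures_def prob_space_return)

lemma snd_marginal_prob_measures:
  assumes "\<mu> \<in> prob_measures (prod_topology X1 X2)"
  shows "snd_marginal X1 X2 \<mu> \<in> prob_measures X2"
proof -
  interpret prob_space \<mu> by (rule prob_measuresD(1)[OF assms])
  have sp: "space (snd_marginal X1 X2 \<mu>) = topspace X2"
    using sets_eq_imp_space_eq[OF sets_snd_marginal, of X1 X2 \<mu>] by simp
  have "emeasure (snd_marginal X1 X2 \<mu>) (topspace X2) = emeasure \<mu> (space \<mu>)"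
    using emeasure_snd_marginal[OF prob_measuresD(2)[OF assms] sets.top] prob_measuresD(3)[OF assms] by simp
  then have "prob_space (snd_marginal X1 X2 \<mu>)"
    using sp emeasure_space_1 by (intro prob_spaceI) simp
  then show ?thesis by (simp add: prob_measures_def)
qed

text \<open>Slicing at a fixed \<open>B\<close> commutes with averaging over \<open>z\<close>: the
  slice of the joint kernel is the bind of \<open>z\<close> with the slices of \<open>P\<close>.
  These are subprobability measures, which supplies the mass bound 1 for integration against a
  bind.\<close>

lemma integral_fst_slice_joint_kernel:
  assumes P: "stochastic_kernel (prod_topology XW XY) (prod_topology XW (prod_topology XY XA)) P"
    and z: "z \<in> prob_measures XW" and ya: "y \<in> topspace XY" "a \<in> topspace XA"
    and B: "B \<in> sets (borel_of XY)" and f: "f \<in> bounded_cont XW"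
  shows "(\<integral>x. f x \<partial>(fst_slice XW (joint_kernel P (z, y, a)) B)) =
    (\<integral>w. \<integral>x. f x \<partial>(fst_slice XW (P (w, y, a)) B) \<partial>z)"
proof -
  interpret z: prob_space z by (rule prob_measuresD(1)[OF z])
  note K = kernel_section_measurable[OF P ya]
  have N: "(\<lambda>w. fst_slice XW (P (w, y, a)) B) \<in> z \<rightarrow>\<^sub>M subprob_algebra (borel_of XW)"
    using fst_slice_kernel_measurable[OF K B] by (simp add: measurable_cong_sets[OF prob_measuresD(2)[OF z] refl])
  have Pw: "P (w, y, a) \<in> prob_measures (prod_topology XW XY)" if "w \<in> space z" for w
    using measurable_space[OF K, of w] that prob_measuresD(3)[OF z] by (simp add: space_prob_algebra_borel_of)
  have "fst_slice XW (joint_kernel P (z, y, a)) B = z \<bind> (\<lambda>w. fst_slice XW (P (w, y, a)) B)"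
  proof (rule measure_eqI)
    show "sets (fst_slice XW (joint_kernel P (z, y, a)) B) = sets (z \<bind> (\<lambda>w. fst_slice XW (P (w, y, a)) B))"
      using z.not_empty by (subst sets_bind[of _ _ "borel_of XW"]) auto
    fix E assume "E \<in> sets (fst_slice XW (joint_kernel P (z, y, a)) B)"
    then have E: "E \<in> sets (borel_of XW)" by simp
    have "emeasure (fst_slice XW (joint_kernel P (z, y, a)) B) E = emeasure (joint_kernel P (z, y, a)) (E \<times> B)"
      using prob_measuresD(2)[OF joint_kernel_prob_measures[OF P z ya]] B E by (rule emeasure_fst_slice)
    also have "\<dots> = (\<integral>\<^sup>+w. emeasure (P (w, y, a)) (E \<times> B) \<partial>z)"
      by (rule emeasure_joint_kernel[OF P z ya times_in_borel_of_prod[OF E B]])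
    also have "\<dots> = (\<integral>\<^sup>+w. emeasure (fst_slice XW (P (w, y, a)) B) E \<partial>z)"
      using emeasure_fst_slice[OF prob_measuresD(2)[OF Pw] B E] by (intro nn_integral_cong) simp
    also have "\<dots> = emeasure (z \<bind> (\<lambda>w. fst_slice XW (P (w, y, a)) B)) E"
      by (rule emeasure_bind[OF z.not_empty N E, symmetric])
    finally show "emeasure (fst_slice XW (joint_kernel P (z, y, a)) B) E = emeasure (z \<bind> (\<lambda>w. fst_slice XW (P (w, y, a)) B)) E" .
  qed
  moreover obtain C where C: "\<And>x. x \<in> topspace XW \<Longrightarrow> \<bar>f x\<bar> \<le> C" using bounded_contE[OF f] by metis
  ultimately show ?thesis
    using emeasure_fst_slice_le[OF Pw B]
    by (simp, intro integral_bind[where B = C and B' = 1 and K = "borel_of XW"])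
       (auto intro: borel_measurable_bounded_cont[OF f] N z.finite_measure_axioms)
qed

text \<open>Restricting \<mu> to \<open>B\<close> by a density turns the disintegration identity
  into the equation of measures \<open>fst_slice XW R B = ?D \<bind> h\<close>; integrating against
  the bind and removing the density gives the formula.\<close>

lemma integral_fst_slice_disintegration:
  assumes R: "R \<in> prob_measures (prod_topology XW XY)" and \<mu>: "\<mu> \<in> prob_measures XY"
    and h: "h \<in> borel_of XY \<rightarrow>\<^sub>M prob_algebra (borel_of XW)" and B: "B \<in> sets (borel_of XY)"
    and dis: "\<And>E. E \<in> sets (borel_of XW) \<Longrightarrow> emeasure R (E \<times> B) = (\<integral>\<^sup>+y\<in>B. emeasure (h y) E \<partial>\<mu>)"
    and f: "f \<in> bounded_cont XW"
  shows "(\<integral>x. f x \<partial>(fst_slice XW R B)) = (\<integral>y. indicator B y * (\<integral>x. f x \<partial>h y) \<partial>\<mu>)"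
proof -
  interpret \<mu>: prob_space \<mu> by (rule prob_measuresD(1)[OF \<mu>])
  let ?D = "density \<mu> (\<lambda>y. ennreal (indicator B y))"
  have B\<mu> [measurable]: "B \<in> sets \<mu>" using B prob_measuresD(2)[OF \<mu>] by simp
  have h\<mu>: "h \<in> \<mu> \<rightarrow>\<^sub>M subprob_algebra (borel_of XW)"
    using measurable_prob_algebraD[OF h] by (simp add: measurable_cong_sets[OF prob_measuresD(2)[OF \<mu>] refl])
  have N: "h \<in> ?D \<rightarrow>\<^sub>M subprob_algebra (borel_of XW)" using h\<mu> by simp
  have hy: "prob_space (h y)" if "y \<in> space ?D" for y
    using measurable_space[OF h, of y] that prob_measuresD(3)[OF \<mu>] by (simp add: space_prob_algebra)
  have "emeasure ?D (space ?D) = emeasure \<mu> B"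
    using sets.sets_into_space[OF B\<mu>]
    by (subst emeasure_density) (auto simp: ennreal_indicator nn_integral_indicator simp flip: indicator_inter_arith intro!: arg_cong[where f = "emeasure \<mu>"])
  then have fin: "finite_measure ?D" by (intro finite_measureI) simp
  have ne: "space ?D \<noteq> {}" using \<mu>.not_empty by simp
  have "fst_slice XW R B = ?D \<bind> h"
  proof (rule measure_eqI)
    show "sets (fst_slice XW R B) = sets (?D \<bind> h)"
      using sets_kernel[OF N] ne by (subst sets_bind[of _ _ "borel_of XW"]) auto
    fix E assume "E \<in> sets (fst_slice XW R B)"
    then have E: "E \<in> sets (borel_of XW)" by simp
    have mE: "(\<lambda>y. emeasure (h y) E) \<in> borel_measurable \<mu>" by (rule measurable_emeasure_kernel[OF h\<mu> E])
    have "emeasure (fst_slice XW R B) E = (\<integral>\<^sup>+y\<in>B. emeasure (h y) E \<partial>\<mu>)"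
      using emeasure_fst_slice[OF prob_measuresD(2)[OF R] B E] dis[OF E] by simp
    also have "\<dots> = (\<integral>\<^sup>+y. emeasure (h y) E \<partial>?D)"
      using mE by (simp add: nn_integral_density ennreal_indicator mult.commute)
    also have "\<dots> = emeasure (?D \<bind> h) E" by (rule emeasure_bind[OF ne N E, symmetric])
    finally show "emeasure (fst_slice XW R B) E = emeasure (?D \<bind> h) E" .
  qed
  moreover obtain C where C: "\<And>x. x \<in> topspace XW \<Longrightarrow> \<bar>f x\<bar> \<le> C" using bounded_contE[OF f] by metis
  have "(\<integral>x. f x \<partial>(?D \<bind> h)) = (\<integral>y. \<integral>x. f x \<partial>h y \<partial>?D)"
  proof (rule integral_bind[where B = C and B' = 1 and K = "borel_of XW"])
    show "AE y in ?D. emeasure (h y) (space (h y)) \<le> ennreal 1"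
      using hy prob_space.emeasure_space_1 by (intro AE_I2) fastforce
  qed (use C N fin borel_measurable_bounded_cont[OF f] in auto)
  moreover have "(\<integral>y. \<integral>x. f x \<partial>h y \<partial>?D) = (\<integral>y. indicator B y *\<^sub>R (\<integral>x. f x \<partial>h y) \<partial>\<mu>)"
    using measurable_compose[OF h\<mu> integral_measurable_subprob_algebra[OF borel_measurable_bounded_cont[OF f]]]
    by (intro integral_density) auto
  ultimately show ?thesis by simp
qed

text \<open>Here the slice is the image under \<open>h\<close> of \<mu> restricted to
  \<open>B\<close>. Borel measurability of \<open>h\<close> into \<open>XZ\<close> is what makes
  this image measure meaningful; for filters \<open>XZ\<close> is the weak topology.\<close>

lemma integral_fst_slice_pushforward:
  assumes Q: "Q \<in> prob_measures (prod_topology XZ XY)" and \<mu>: "\<mu> \<in> prob_measures XY"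
    and h: "h \<in> borel_of XY \<rightarrow>\<^sub>M borel_of XZ" and B: "B \<in> sets (borel_of XY)"
    and push: "\<And>D. D \<in> sets (borel_of XZ) \<Longrightarrow> emeasure Q (D \<times> B) = (\<integral>\<^sup>+y\<in>B. indicator D (h y) \<partial>\<mu>)"
    and f: "f \<in> bounded_cont XZ"
  shows "(\<integral>x. f x \<partial>(fst_slice XZ Q B)) = (\<integral>y. indicator B y * f (h y) \<partial>\<mu>)"
proof -
  let ?D = "density \<mu> (\<lambda>y. ennreal (indicator B y))"
  have B\<mu> [measurable]: "B \<in> sets \<mu>" using B prob_measuresD(2)[OF \<mu>] by simp
  have h\<mu>: "h \<in> \<mu> \<rightarrow>\<^sub>M borel_of XZ"
    using h by (simp add: measurable_cong_sets[OF prob_measuresD(2)[OF \<mu>] refl])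
  have N: "h \<in> ?D \<rightarrow>\<^sub>M borel_of XZ" using h\<mu> by simp
  have "fst_slice XZ Q B = distr ?D (borel_of XZ) h"
  proof (rule measure_eqI)
    fix E assume "E \<in> sets (fst_slice XZ Q B)"
    then have E: "E \<in> sets (borel_of XZ)" by simp
    have mE: "(\<lambda>y. indicator E (h y) :: ennreal) \<in> borel_measurable \<mu>"
      using measurable_compose[OF h\<mu> borel_measurable_indicator[OF E]] .
    have "emeasure (fst_slice XZ Q B) E = (\<integral>\<^sup>+y\<in>B. indicator E (h y) \<partial>\<mu>)"
      using emeasure_fst_slice[OF prob_measuresD(2)[OF Q] B E] push[OF E] by simp
    also have "\<dots> = (\<integral>\<^sup>+y. indicator E (h y) \<partial>?D)"
      using mE by (simp add: nn_integral_density ennreal_indicator mult.commute)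
    also have "\<dots> = (\<integral>\<^sup>+x. indicator E x \<partial>distr ?D (borel_of XZ) h)"
      using E by (intro nn_integral_distr[OF N, symmetric]) simp
    also have "\<dots> = emeasure (distr ?D (borel_of XZ) h) E" using E by simp
    finally show "emeasure (fst_slice XZ Q B) E = emeasure (distr ?D (borel_of XZ) h) E" .
  qed simp
  then have "(\<integral>x. f x \<partial>(fst_slice XZ Q B)) = (\<integral>y. f (h y) \<partial>?D)"
    using integral_distr[OF N borel_measurable_bounded_cont[OF f]] by simp
  also have "\<dots> = (\<integral>y. indicator B y *\<^sub>R f (h y) \<partial>\<mu>)"
    using measurable_compose[OF h\<mu> borel_measurable_bounded_cont[OF f]] by (intro integral_density) auto
  finally show ?thesis by simp
qed

subsection \<open>Convergence of filters\<close>


text \<open>The sets where \<open>g\<close> is nonnegative and where it is negative contribute at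
  most \<open>e\<close> each. This is how an estimate uniform in \<open>B\<close> becomes an L1
  estimate.\<close>

lemma integral_abs_le_of_set_integrals:
  fixes g :: "'a \<Rightarrow> real"
  assumes M: "finite_measure M" and g: "integrable M g"
    and B: "\<And>B. B \<in> sets M \<Longrightarrow> \<bar>\<integral>x. indicator B x * g x \<partial>M\<bar> \<le> e"
  shows "(\<integral>x. \<bar>g x\<bar> \<partial>M) \<le> 2 * e"
proof -
  define P where "P = {x \<in> space M. 0 \<le> g x}"
  define N where "N = {x \<in> space M. \<not> 0 \<le> g x}"
  have [measurable]: "g \<in> borel_measurable M" using g by simp
  have PN: "P \<in> sets M" "N \<in> sets M" unfolding P_def N_def by measurable
  have int: "integrable M (\<lambda>x. indicator A x * g x)" if "A \<in> sets M" for A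
    using integrable_mult_indicator[OF that g] by simp
  have "(\<integral>x. \<bar>g x\<bar> \<partial>M) = (\<integral>x. indicator P x * g x - indicator N x * g x \<partial>M)"
    by (intro Bochner_Integration.integral_cong) (auto simp: P_def N_def indicator_def)
  also have "\<dots> = (\<integral>x. indicator P x * g x \<partial>M) - (\<integral>x. indicator N x * g x \<partial>M)"
    by (rule Bochner_Integration.integral_diff[OF int[OF PN(1)] int[OF PN(2)]])
  also have "\<dots> \<le> 2 * e" using B[OF PN(1)] B[OF PN(2)] by linarith
  finally show ?thesis .
qed

text \<open>L1 convergence gives an almost everywhere convergent subsequence for one
  \<open>g\<close>, and this property passes to further subsequences, so refining successively along
  an enumeration of \<open>G\<close> and taking the diagonal works for all \<open>g\<close>.\<close>

lemma AE_convergent_subsequence_countable: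
  fixes u :: "'i \<Rightarrow> nat \<Rightarrow> 'a \<Rightarrow> real"
  assumes G: "countable G"
    and int: "\<And>g n. g \<in> G \<Longrightarrow> integrable M (u g n)"
    and lim: "\<And>g. g \<in> G \<Longrightarrow> (\<lambda>n. \<integral>x. \<bar>u g n x\<bar> \<partial>M) \<longlonglongrightarrow> 0"
  obtains d :: "nat \<Rightarrow> nat" where "strict_mono d" "AE x in M. \<forall>g \<in> G. (\<lambda>n. u g (d n) x) \<longlonglongrightarrow> 0"
proof (cases "G = {}")
  case True
  show thesis by (rule that[of id]) (simp_all add: True strict_mono_def)
next
  case False
  define c where "c = from_nat_into G"
  have cG: "c j \<in> G" for j using from_nat_into[OF False] by (simp add: c_def)
  interpret subseqs "\<lambda>j s. AE x in M. (\<lambda>n. u (c j) (s n) x) \<longlonglongrightarrow> 0"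
  proof
    fix j and s :: "nat \<Rightarrow> nat" assume s: "strict_mono s"
    have "(\<lambda>n. \<integral>x. norm (u (c j) (s n) x) \<partial>M) \<longlonglongrightarrow> 0"
      using LIMSEQ_subseq_LIMSEQ[OF lim[OF cG[of j]] s] by (simp add: o_def)
    from tendsto_L1_AE_subseq[OF int[OF cG] this]
    show "\<exists>r'. strict_mono r' \<and> (AE x in M. (\<lambda>n. u (c j) ((s \<circ> r') n) x) \<longlonglongrightarrow> 0)"
      by (simp add: o_def)
  qed
  have "AE x in M. (\<lambda>n. u (c j) (diagseq n) x) \<longlonglongrightarrow> 0" for j
  proof -
    \<comment> \<open>From index \<open>Suc j\<close> on, the diagonal sequence is a subsequence of
      the one selected at stage \<open>j\<close>; the offset is removed afterwards.\<close>
    have "AE x in M. (\<lambda>n. u (c j) ((diagseq \<circ> (+) (Suc j)) n) x) \<longlonglongrightarrow> 0"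
    proof (rule diagseq_holds)
      fix r s :: "nat \<Rightarrow> nat" and n
      assume r: "strict_mono r" and ae: "AE x in M. (\<lambda>i. u (c n) (s i) x) \<longlonglongrightarrow> 0"
      show "AE x in M. (\<lambda>i. u (c n) ((s \<circ> r) i) x) \<longlonglongrightarrow> 0"
        using ae
      proof eventually_elim
        case (elim x)
        show ?case using LIMSEQ_subseq_LIMSEQ[OF elim r] by (simp add: o_def)
      qed
    qed
    then show ?thesis
    proof eventually_elim
      case (elim x)
      have "(\<lambda>n. u (c j) (diagseq (n + Suc j)) x) \<longlonglongrightarrow> 0" using elim by (simp add: o_def add.commute)
      then show ?case by (rule LIMSEQ_offset)
    qed
  qed
  then have "AE x in M. \<forall>j. (\<lambda>n. u (c j) (diagseq n) x) \<longlonglongrightarrow> 0" by (simp add: AE_all_countable)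
  then have "AE x in M. \<forall>g \<in> G. (\<lambda>n. u g (diagseq n) x) \<longlonglongrightarrow> 0"
  proof eventually_elim
    case (elim x)
    show ?case
    proof
      fix g assume "g \<in> G"
      then obtain j where "c j = g" using from_nat_into_surj[OF G] by (auto simp: c_def)
      then show "(\<lambda>n. u g (diagseq n) x) \<longlonglongrightarrow> 0" using elim by auto
    qed
  qed
  with subseq_diagseq show thesis by (rule that)
qed

text \<open>The premise \<open>conv\<close> is the conclusion restricted to the special functions
  \<nu> \<mapsto> \<integral>f d\<nu>. To reach a general \<open>F\<close>, the difference is split
  at the integral of \<open>F (h n y)\<close> under \<open>\<mu>0\<close>: one part is a change of
  measure for integrands with a common bound, the other is at most the L1 distance of
  \<open>F (h n y)\<close> and \<open>F (h0 y)\<close> under \<open>\<mu>0\<close>. Neither bound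
  depends on \<open>B\<close>.\<close>

lemma filter_semi_uniform_convergence:
  fixes S :: "'a::{metric_space, second_countable_topology} set"
  assumes \<mu>: "\<And>n. \<mu> n \<in> prob_measures XY" and \<mu>0: "\<mu>0 \<in> prob_measures XY"
    and h: "\<And>n. h n \<in> borel_of XY \<rightarrow>\<^sub>M prob_algebra (borel_of (top_of_set S))"
    and h0: "h0 \<in> borel_of XY \<rightarrow>\<^sub>M prob_algebra (borel_of (top_of_set S))"
    and conv: "\<And>f e. f \<in> bounded_cont (top_of_set S) \<Longrightarrow> 0 < e \<Longrightarrow>
      \<forall>\<^sub>F n in sequentially. \<forall>B \<in> sets (borel_of XY).
        \<bar>(\<integral>y. indicator B y * (\<integral>x. f x \<partial>h n y) \<partial>\<mu> n) - (\<integral>y. indicator B y * (\<integral>x. f x \<partial>h0 y) \<partial>\<mu>0)\<bar> \<le> e"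
    and F: "F \<in> bounded_cont (weak_topology (top_of_set S))" and e: "0 < e"
  shows "\<forall>\<^sub>F n in sequentially. \<forall>B \<in> sets (borel_of XY).
        \<bar>(\<integral>y. indicator B y * F (h n y) \<partial>\<mu> n) - (\<integral>y. indicator B y * F (h0 y) \<partial>\<mu>0)\<bar> \<le> e"
proof -
  let ?X = "top_of_set S"
  interpret \<mu>0: prob_space \<mu>0 by (rule prob_measuresD(1)[OF \<mu>0])
  have s\<mu>: "sets (\<mu> n) = sets (borel_of XY)" "space (\<mu> n) = topspace XY" for n
    using prob_measuresD(2,3)[OF \<mu>] by auto
  have s\<mu>0: "sets \<mu>0 = sets (borel_of XY)" "space \<mu>0 = topspace XY"
    using prob_measuresD(2,3)[OF \<mu>0] by auto
  have m0: "borel_measurable \<mu>0 = borel_measurable (borel_of XY)"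
    by (rule measurable_cong_sets[OF s\<mu>0(1) refl])
  have m: "borel_measurable (\<mu> n) = borel_measurable (borel_of XY)" for n
    by (rule measurable_cong_sets[OF s\<mu>(1) refl])
  have hP: "k y \<in> prob_measures ?X" if "k \<in> borel_of XY \<rightarrow>\<^sub>M prob_algebra (borel_of ?X)" "y \<in> topspace XY" for k y
    using measurable_space[OF that(1), of y] that(2) by (simp add: space_prob_algebra_borel_of)

  have TV: "\<forall>\<^sub>F n in sequentially. \<forall>B \<in> sets (borel_of XY). \<bar>measure (\<mu> n) B - measure \<mu>0 B\<bar> \<le> e" if e: "0 < e" for e
  proof -
    have one: "(\<lambda>_. 1) \<in> bounded_cont ?X" by (auto simp: bounded_cont_top_of_set intro!: boundedI[of _ 1])
    have one_int: "(\<integral>x. 1 \<partial>k y) = (1::real)"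
      if "k \<in> borel_of XY \<rightarrow>\<^sub>M prob_algebra (borel_of ?X)" "y \<in> topspace XY" for k y
      using prob_space.prob_space[OF prob_measuresD(1)[OF hP[OF that]]] by simp
    have eq: "(\<integral>y. indicator B y * (\<integral>x. 1 \<partial>k y) \<partial>\<nu>) = measure \<nu> B"
      if "k \<in> borel_of XY \<rightarrow>\<^sub>M prob_algebra (borel_of ?X)" "\<nu> \<in> prob_measures XY" "B \<in> sets (borel_of XY)" for k B \<nu>
    proof -
      have "(\<integral>y. indicator B y * (\<integral>x. 1 \<partial>k y) \<partial>\<nu>) = (\<integral>y. indicator B y \<partial>\<nu> :: real)"
      proof (intro Bochner_Integration.integral_cong refl)
        fix y assume "y \<in> space \<nu>"
        then have "(\<integral>x. 1 \<partial>k y) = (1::real)" using that(1,2) prob_measuresD(3) by (intro one_int) auto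
        then show "indicator B y * (\<integral>x. 1 \<partial>k y) = (indicator B y :: real)" by simp
      qed
      then show ?thesis using that(3) prob_measuresD(2,3)[OF that(2)] sets.sets_into_space[OF that(3)]
        by (simp add: Int_absorb2)
    qed
    show ?thesis using conv[OF one e]
    proof eventually_elim
      case (elim n)
      show ?case
      proof
        fix B assume B: "B \<in> sets (borel_of XY)"
        show "\<bar>measure (\<mu> n) B - measure \<mu>0 B\<bar> \<le> e"
          using bspec[OF elim B] by (simp only: eq[OF h \<mu> B] eq[OF h0 \<mu>0 B])
      qed
    qed
  qed

  \<comment> \<open>The integrand may vary with \<open>n\<close>, since closeness in total variation
    is uniform over all integrands bounded by \<open>C\<close>.\<close>
  have TV': "\<forall>\<^sub>F n in sequentially. \<forall>B \<in> sets (borel_of XY).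
      \<bar>(\<integral>y. indicator B y * k n y \<partial>\<mu> n) - (\<integral>y. indicator B y * k n y \<partial>\<mu>0)\<bar> \<le> e"
    if k: "\<And>n. k n \<in> borel_measurable (borel_of XY)" "\<And>n y. y \<in> topspace XY \<Longrightarrow> \<bar>k n y\<bar> \<le> C"
      and C: "0 < C" and e: "0 < e" for k :: "nat \<Rightarrow> _ \<Rightarrow> real" and C e
  proof -
    have pos: "0 < e / (2 * C)" using e C by simp
    show ?thesis using TV[OF pos]
    proof eventually_elim
      case (elim n)
      show ?case
      proof
        fix B assume B: "B \<in> sets (borel_of XY)"
        have "\<bar>(\<integral>y. indicator B y * k n y \<partial>\<mu> n) - (\<integral>y. indicator B y * k n y \<partial>\<mu>0)\<bar> \<le> 2 * C * (e / (2 * C))"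
        proof (rule abs_integral_diff_le_of_setwise_close[OF prob_measuresD(1)[OF \<mu>] prob_measuresD(1)[OF \<mu>0]])
          show "(\<lambda>y. indicator B y * k n y) \<in> borel_measurable (\<mu> n)"
            unfolding m using k(1) B by (intro borel_measurable_times borel_measurable_indicator)
          show "\<bar>indicator B y * k n y\<bar> \<le> C" if "y \<in> space (\<mu> n)" for y
            using k(2)[of y n] that C s\<mu>(2) by (auto simp: indicator_def)
        qed (use elim s\<mu> s\<mu>0 C in auto)
        then show "\<bar>(\<integral>y. indicator B y * k n y \<partial>\<mu> n) - (\<integral>y. indicator B y * k n y \<partial>\<mu>0)\<bar> \<le> e"
          using C by simp
      qed
    qed
  qed

  have meas_int: "(\<lambda>y. \<integral>x. f x \<partial>k y) \<in> borel_measurable (borel_of XY)"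
    if "k \<in> borel_of XY \<rightarrow>\<^sub>M prob_algebra (borel_of ?X)" "f \<in> bounded_cont ?X" for k f
    using measurable_compose[OF measurable_prob_algebraD[OF that(1)]
        integral_measurable_subprob_algebra[OF borel_measurable_bounded_cont[OF that(2)]]] .
  have bd_int: "\<bar>\<integral>x. f x \<partial>k y\<bar> \<le> C"
    if k: "k \<in> borel_of XY \<rightarrow>\<^sub>M prob_algebra (borel_of ?X)" and f: "f \<in> bounded_cont ?X" and y: "y \<in> topspace XY"
      and C: "\<And>x. x \<in> topspace ?X \<Longrightarrow> \<bar>f x\<bar> \<le> C" "0 < C" for k f C y
  proof -
    note ky = hP[OF k y]
    show ?thesis
      using borel_measurable_bounded_cont[OF f] C prob_measuresD(3)[OF ky]
      by (intro subprob_space.abs_integral_le_bound prob_space_imp_subprob_space prob_measuresD(1)[OF ky])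
         (auto simp: measurable_cong_sets[OF prob_measuresD(2)[OF ky] refl])
  qed

  define u where "u g n y = (\<integral>x. g x \<partial>h n y) - (\<integral>x. g x \<partial>h0 y)" for g :: "'a \<Rightarrow> real" and n y
  have u_int: "integrable \<mu>0 (u g n)" if g: "g \<in> bounded_cont ?X" for g n
  proof -
    obtain C where C: "0 < C" "\<And>x. x \<in> topspace ?X \<Longrightarrow> \<bar>g x\<bar> \<le> C" using bounded_contE[OF g] by metis
    have "\<bar>u g n y\<bar> \<le> C + C" if "y \<in> space \<mu>0" for y
      using bd_int[OF h g _ C(2,1), of y n] bd_int[OF h0 g _ C(2,1), of y] that s\<mu>0(2) unfolding u_def by simp
    moreover have "u g n \<in> borel_measurable \<mu>0"
      unfolding u_def[abs_def] m0 by (intro borel_measurable_diff meas_int h h0 g)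
    ultimately show ?thesis by (intro \<mu>0.integrable_abs_bounded[of _ "C + C"])
  qed
  have u_L1: "(\<lambda>n. \<integral>y. \<bar>u g n y\<bar> \<partial>\<mu>0) \<longlonglongrightarrow> 0" if g: "g \<in> bounded_cont ?X" for g
  proof (rule tendstoI)
    fix e :: real assume e: "0 < e"
    obtain C where C: "0 < C" "\<And>x. x \<in> topspace ?X \<Longrightarrow> \<bar>g x\<bar> \<le> C" using bounded_contE[OF g] by metis
    \<comment> \<open>Replacing \<open>\<mu> n\<close> by \<open>\<mu>0\<close> costs
      \<open>e / 8\<close> and \<open>conv\<close> costs \<open>e / 8\<close>, so every set integral
      of \<open>u g n\<close> is at most \<open>e / 4\<close>; doubling for the two signs gives an
      L1 norm of at most \<open>e / 2 < e\<close>.\<close>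
    have e8: "0 < e / 8" using e by simp
    have "\<forall>\<^sub>F n in sequentially. \<forall>B \<in> sets (borel_of XY).
      \<bar>(\<integral>y. indicator B y * (\<integral>x. g x \<partial>h n y) \<partial>\<mu> n) - (\<integral>y. indicator B y * (\<integral>x. g x \<partial>h n y) \<partial>\<mu>0)\<bar> \<le> e / 8"
      by (rule TV'[OF meas_int[OF h g] bd_int[OF h g _ C(2,1)] C(1) e8])
    then show "\<forall>\<^sub>F n in sequentially. dist (\<integral>y. \<bar>u g n y\<bar> \<partial>\<mu>0) 0 < e"
      using conv[OF g e8]
    proof eventually_elim
      case (elim n)
      have ii: "integrable \<mu>0 (\<lambda>y. indicator B y * (\<integral>x. g x \<partial>k y))"
        if "B \<in> sets \<mu>0" "k \<in> borel_of XY \<rightarrow>\<^sub>M prob_algebra (borel_of ?X)" for B k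
      proof -
        have "integrable \<mu>0 (\<lambda>y. \<integral>x. g x \<partial>k y)"
          using meas_int[OF that(2) g] bd_int[OF that(2) g _ C(2,1)] s\<mu>0(2) m0
          by (intro \<mu>0.integrable_abs_bounded[of _ C]) auto
        from integrable_mult_indicator[OF that(1) this] show ?thesis by simp
      qed
      have "(\<integral>y. \<bar>u g n y\<bar> \<partial>\<mu>0) \<le> 2 * (e / 4)"
      proof (rule integral_abs_le_of_set_integrals[OF \<mu>0.finite_measure_axioms u_int[OF g]])
        fix B assume B: "B \<in> sets \<mu>0"
        have "(\<integral>y. indicator B y * u g n y \<partial>\<mu>0) =
          (\<integral>y. indicator B y * (\<integral>x. g x \<partial>h n y) \<partial>\<mu>0) - (\<integral>y. indicator B y * (\<integral>x. g x \<partial>h0 y) \<partial>\<mu>0)"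
          unfolding u_def right_diff_distrib
          by (rule Bochner_Integration.integral_diff[OF ii[OF B h] ii[OF B h0]])
        then show "\<bar>\<integral>y. indicator B y * u g n y \<partial>\<mu>0\<bar> \<le> e / 4"
          using elim[THEN bspec, OF B[unfolded s\<mu>0(1)]] by linarith
      qed
      moreover have "0 \<le> (\<integral>y. \<bar>u g n y\<bar> \<partial>\<mu>0)" by simp
      ultimately show ?case using e by simp
    qed
  qed

  obtain C where C: "0 < C" "\<And>\<nu>. \<nu> \<in> prob_measures ?X \<Longrightarrow> \<bar>F \<nu>\<bar> \<le> C"
    using bounded_contE[OF F] unfolding topspace_weak_topology by metis
  have F_meas: "(\<lambda>y. F (k y)) \<in> borel_measurable (borel_of XY)"
    if "k \<in> borel_of XY \<rightarrow>\<^sub>M prob_algebra (borel_of ?X)" for k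
    using measurable_compose[OF measurable_borel_of_weak_topology[OF that] borel_measurable_bounded_cont[OF F]] .
  have F_int: "integrable \<mu>0 (\<lambda>y. F (k y))" if "k \<in> borel_of XY \<rightarrow>\<^sub>M prob_algebra (borel_of ?X)" for k
    using F_meas[OF that] C(2) hP[OF that] s\<mu>0(2) m0 by (intro \<mu>0.integrable_abs_bounded[of _ C]) auto

  \<comment> \<open>Weak convergence of the filters holds almost surely only along subsequences. A
    subsequence with L1 distances of at least \<open>e\<close> would have a further subsequence
    along which dominated convergence, with the constant \<open>2 * C\<close>, forces them to
    0.\<close>
  have F_L1: "\<forall>\<^sub>F n in sequentially. (\<integral>y. \<bar>F (h n y) - F (h0 y)\<bar> \<partial>\<mu>0) < e" if e: "0 < e" for e
  proof (rule ccontr)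
    assume "\<not> (\<forall>\<^sub>F n in sequentially. (\<integral>y. \<bar>F (h n y) - F (h0 y)\<bar> \<partial>\<mu>0) < e)"
    from not_eventually_sequentiallyD[OF this]
    obtain r :: "nat \<Rightarrow> nat" where r: "strict_mono r"
      "\<And>n. e \<le> (\<integral>y. \<bar>F (h (r n) y) - F (h0 y)\<bar> \<partial>\<mu>0)" by (auto simp: not_less)
    obtain G where G: "countable G" "G \<subseteq> bounded_cont ?X" and
      weak: "\<And>\<nu> \<mu>. \<mu> \<in> prob_measures ?X \<Longrightarrow> (\<And>n. \<nu> n \<in> prob_measures ?X) \<Longrightarrow>
         (\<And>g. g \<in> G \<Longrightarrow> (\<lambda>n. \<integral>x. g x \<partial>\<nu> n) \<longlonglongrightarrow> (\<integral>x. g x \<partial>\<mu>)) \<Longrightarrow>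
         limitin (weak_topology ?X) \<nu> \<mu> sequentially"
      using limitin_weak_topology_if_tendsto_on[of S] by blast
    have "(\<lambda>n. \<integral>y. \<bar>u g (r n) y\<bar> \<partial>\<mu>0) \<longlonglongrightarrow> 0" if "g \<in> G" for g
      using LIMSEQ_subseq_LIMSEQ[OF u_L1 r(1), of g] that G(2) by (auto simp: o_def)
    then obtain d :: "nat \<Rightarrow> nat" where d: "AE y in \<mu>0. \<forall>g \<in> G. (\<lambda>n. u g (r (d n)) y) \<longlonglongrightarrow> 0"
      using AE_convergent_subsequence_countable[of G \<mu>0 "\<lambda>g n. u g (r n)"] G u_int by (metis subset_eq)
    have lim: "AE y in \<mu>0. (\<lambda>n. F (h (r (d n)) y)) \<longlonglongrightarrow> F (h0 y)"
      using d AE_space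
    proof eventually_elim
      case (elim y)
      then have y: "y \<in> topspace XY" using s\<mu>0(2) by simp
      have "limitin (weak_topology ?X) (\<lambda>n. h (r (d n)) y) (h0 y) sequentially"
      proof (rule weak[OF hP[OF h0 y] hP[OF h y]])
        fix g assume "g \<in> G"
        then show "(\<lambda>n. \<integral>x. g x \<partial>h (r (d n)) y) \<longlonglongrightarrow> (\<integral>x. g x \<partial>h0 y)"
          using elim(1) by (auto simp: u_def intro: LIM_zero_cancel)
      qed
      moreover have "continuous_map (weak_topology ?X) euclideanreal F" using F by (simp add: bounded_cont_def)
      ultimately show ?case
        using continuous_map_limit by (fastforce simp: o_def)
    qed
    have "(\<lambda>n. \<integral>y. \<bar>F (h (r (d n)) y) - F (h0 y)\<bar> \<partial>\<mu>0) \<longlonglongrightarrow> (\<integral>y. 0 \<partial>\<mu>0)"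
    proof (rule integral_dominated_convergence[where w = "\<lambda>_. 2 * C"])
      show "AE y in \<mu>0. (\<lambda>n. \<bar>F (h (r (d n)) y) - F (h0 y)\<bar>) \<longlonglongrightarrow> 0"
        using lim by eventually_elim (intro tendsto_rabs_zero LIM_zero)
      show "AE y in \<mu>0. norm \<bar>F (h (r (d n)) y) - F (h0 y)\<bar> \<le> 2 * C" for n
      proof (rule AE_I2)
        fix y assume "y \<in> space \<mu>0"
        then have y: "y \<in> topspace XY" using s\<mu>0(2) by simp
        show "norm \<bar>F (h (r (d n)) y) - F (h0 y)\<bar> \<le> 2 * C"
          using C(2)[OF hP[OF h y], of "r (d n)"] C(2)[OF hP[OF h0 y]] by simp
      qed
      show "(\<lambda>y. \<bar>F (h (r (d n)) y) - F (h0 y)\<bar>) \<in> borel_measurable \<mu>0" for n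
        unfolding m0 by (intro borel_measurable_abs borel_measurable_diff F_meas h h0)
    qed simp_all
    then have "(\<lambda>n. \<integral>y. \<bar>F (h (r (d n)) y) - F (h0 y)\<bar> \<partial>\<mu>0) \<longlonglongrightarrow> 0" by simp
    then have "e \<le> 0" using r(2) by (intro LIMSEQ_le_const) auto
    with e show False by simp
  qed

  have e2: "0 < e / 2" using e by simp
  have "\<forall>\<^sub>F n in sequentially. \<forall>B \<in> sets (borel_of XY).
      \<bar>(\<integral>y. indicator B y * F (h n y) \<partial>\<mu> n) - (\<integral>y. indicator B y * F (h n y) \<partial>\<mu>0)\<bar> \<le> e / 2"
    by (rule TV'[OF F_meas[OF h] C(2)[OF hP[OF h]] C(1) e2])
  then show ?thesis using F_L1[OF e2]
  proof eventually_elim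
    case (elim n)
    show ?case
    proof
      fix B assume B: "B \<in> sets (borel_of XY)"
      then have B0: "B \<in> sets \<mu>0" using s\<mu>0(1) by simp
      have ii: "integrable \<mu>0 (\<lambda>y. indicator B y * F (k y))"
        if "k \<in> borel_of XY \<rightarrow>\<^sub>M prob_algebra (borel_of ?X)" for k
        using integrable_mult_indicator[OF B0 F_int[OF that]] by simp
      have "(\<integral>y. indicator B y * F (h n y) \<partial>\<mu>0) - (\<integral>y. indicator B y * F (h0 y) \<partial>\<mu>0) =
        (\<integral>y. indicator B y * F (h n y) - indicator B y * F (h0 y) \<partial>\<mu>0)"
        by (rule Bochner_Integration.integral_diff[OF ii[OF h] ii[OF h0], symmetric])
      moreover have "\<bar>\<dots>\<bar> \<le> (\<integral>y. \<bar>indicator B y * F (h n y) - indicator B y * F (h0 y)\<bar> \<partial>\<mu>0)"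
        by (rule integral_abs_bound)
      moreover have "\<dots> \<le> (\<integral>y. \<bar>F (h n y) - F (h0 y)\<bar> \<partial>\<mu>0)"
      proof (rule integral_mono)
        show "integrable \<mu>0 (\<lambda>y. \<bar>indicator B y * F (h n y) - indicator B y * F (h0 y)\<bar>)"
          using ii[OF h] ii[OF h0] by (intro integrable_abs Bochner_Integration.integrable_diff)
        show "integrable \<mu>0 (\<lambda>y. \<bar>F (h n y) - F (h0 y)\<bar>)"
          using F_int[OF h] F_int[OF h0] by (intro integrable_abs Bochner_Integration.integrable_diff)
      qed (auto simp: indicator_def)
      ultimately show "\<bar>(\<integral>y. indicator B y * F (h n y) \<partial>\<mu> n) - (\<integral>y. indicator B y * F (h0 y) \<partial>\<mu>0)\<bar> \<le> e"
        using elim(1)[rule_format, OF B] elim(2) by linarith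
    qed
  qed
qed

subsection \<open>Semi-uniform Feller kernels\<close>


lemma integral_bounded_cont_weak_topology:
  assumes f: "f \<in> bounded_cont X"
  shows "(\<lambda>\<mu>. \<integral>x. f x \<partial>\<mu>) \<in> bounded_cont (weak_topology X)"
proof -
  obtain C where C: "0 < C" "\<And>x. x \<in> topspace X \<Longrightarrow> \<bar>f x\<bar> \<le> C" using bounded_contE[OF f] by metis
  have "\<bar>\<integral>x. f x \<partial>\<mu>\<bar> \<le> C" if \<mu>: "\<mu> \<in> prob_measures X" for \<mu>
    using borel_measurable_bounded_cont[OF f] C prob_measuresD(3)[OF \<mu>]
    by (intro subprob_space.abs_integral_le_bound prob_space_imp_subprob_space prob_measuresD(1)[OF \<mu>])
       (auto simp: measurable_cong_sets[OF prob_measuresD(2)[OF \<mu>] refl])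
  moreover have "openin (weak_topology X) {\<mu> \<in> prob_measures X. (\<integral>x. f x \<partial>\<mu>) \<in> U}" if "open U" for U
    unfolding weak_topology_def using f that by (intro topology_generated_by_Basis) blast
  ultimately show ?thesis
    by (auto simp: bounded_cont_def continuous_map_def intro!: boundedI)
qed

lemma limitin_return:
  assumes "limitin X \<sigma> w sequentially" "range \<sigma> \<subseteq> topspace X"
  shows "limitin (weak_topology X) (\<lambda>n. return (borel_of X) (\<sigma> n)) (return (borel_of X) w) sequentially"
proof -
  have w: "w \<in> topspace X" using assms(1) by (simp add: limitin_def)
  have \<sigma>: "\<sigma> n \<in> topspace X" for n using assms(2) by auto
  have "(\<lambda>n. f (\<sigma> n)) \<longlonglongrightarrow> f w" if f: "f \<in> bounded_cont X" for f
    using continuous_map_limit[OF _ assms(1), of euclideanreal f] f by (simp add: bounded_cont_def o_def)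
  then show ?thesis
    using w \<sigma> by (simp add: limitin_weak_topology return_in_prob_measures integral_return borel_measurable_bounded_cont)
qed

lemma limitin_compose_filterlim:
  assumes "limitin X f l F" "filterlim g F G"
  shows "limitin X (\<lambda>x. f (g x)) l G"
  using assms eventually_compose_filterlim unfolding limitin_def by blast

text \<open>The Feller property is sequential and \<open>X3\<close> is an arbitrary topology, so the
  conclusion speaks of the tail of a given sequence \<tau> instead of a neighbourhood of
  \<open>t\<close>. If it failed, points \<open>v m\<close> within \<open>1 / (m + 1)\<close> of
  \<open>w\<close> and indices \<open>N m \<ge> m\<close> would violate the estimate, although
  (\<open>v m\<close>, \<open>\<tau> (N m)\<close>) converges to (\<open>w\<close>,
  \<open>t\<close>).\<close>

lemma semi_uniform_Feller_equicontinuous: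
  fixes W :: "'w::metric_space set"
  assumes K: "K \<in> topspace (prod_topology (top_of_set W) X3) \<rightarrow> prob_measures (prod_topology X1 X2)"
    and SUF: "semi_uniform_Feller X1 X2 (prod_topology (top_of_set W) X3) K"
    and f: "f \<in> bounded_cont X1"
    and \<tau>: "limitin X3 \<tau> t sequentially" "range \<tau> \<subseteq> topspace X3"
    and w: "w \<in> W" and e: "0 < e"
  shows "\<exists>r>0. \<forall>\<^sub>F n in sequentially. \<forall>v \<in> W \<inter> ball w r. \<forall>B \<in> sets (borel_of X2).
    \<bar>(\<integral>x. f x \<partial>(fst_slice X1 (K (v, \<tau> n)) B)) - (\<integral>x. f x \<partial>(fst_slice X1 (K (w, t)) B))\<bar> \<le> e"
proof -
  define good where "good s \<longleftrightarrow> (\<forall>B \<in> sets (borel_of X2).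
    \<bar>(\<integral>x. f x \<partial>(fst_slice X1 (K s) B)) - (\<integral>x. f x \<partial>(fst_slice X1 (K (w, t)) B))\<bar> \<le> e)" for s
  have "\<exists>r>0. \<forall>\<^sub>F n in sequentially. \<forall>v \<in> W \<inter> ball w r. good (v, \<tau> n)"
  proof (rule ccontr)
    assume neg: "\<not> (\<exists>r>0. \<forall>\<^sub>F n in sequentially. \<forall>v \<in> W \<inter> ball w r. good (v, \<tau> n))"
    have "\<exists>n v. m \<le> n \<and> v \<in> W \<and> dist w v < 1 / real (Suc m) \<and> \<not> good (v, \<tau> n)" for m
    proof -
      have "\<not> (\<forall>\<^sub>F n in sequentially. \<forall>v \<in> W \<inter> ball w (1 / real (Suc m)). good (v, \<tau> n))"
      proof
        assume "\<forall>\<^sub>F n in sequentially. \<forall>v \<in> W \<inter> ball w (1 / real (Suc m)). good (v, \<tau> n)"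
        then have "\<exists>r>0. \<forall>\<^sub>F n in sequentially. \<forall>v \<in> W \<inter> ball w r. good (v, \<tau> n)"
          by (intro exI[of _ "1 / real (Suc m)"] conjI) simp_all
        with neg show False by blast
      qed
      then have "\<exists>n\<ge>m. \<exists>v \<in> W \<inter> ball w (1 / real (Suc m)). \<not> good (v, \<tau> n)"
        unfolding eventually_sequentially by blast
      then show ?thesis by (elim exE bexE conjE IntE) (auto simp del: of_nat_Suc)
    qed
    then obtain N v where Nv: "\<And>m. m \<le> N m" "\<And>m. v m \<in> W" "\<And>m. dist w (v m) < 1 / real (Suc m)"
      "\<And>m. \<not> good (v m, \<tau> (N m))" by metis
    \<comment> \<open>The bound \<open>m \<le> N m\<close> already makes \<open>N\<close> tend to
      infinity, so reindexing \<tau> by \<open>N\<close> preserves its limit.\<close>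
    have "filterlim N sequentially sequentially"
      using Nv(1) by (intro filterlim_at_top_mono[OF filterlim_ident]) auto
    from limitin_compose_filterlim[OF \<tau>(1) this] have lt: "limitin X3 (\<lambda>m. \<tau> (N m)) t sequentially" .
    have "v \<longlonglongrightarrow> w"
    proof (rule metric_tendsto_imp_tendsto)
      show "(\<lambda>m. 1 / real (Suc m)) \<longlonglongrightarrow> 0" by (rule LIMSEQ_Suc[OF lim_1_over_n])
      show "\<forall>\<^sub>F m in sequentially. dist (v m) w \<le> dist (1 / real (Suc m)) 0"
        using Nv(3) by (intro always_eventually allI) (simp add: dist_commute less_imp_le)
    qed
    then have lv: "limitin (top_of_set W) v w sequentially"
      using Nv(2) w by (simp add: limitin_subtopology)
    have lim: "limitin (prod_topology (top_of_set W) X3) (\<lambda>m. (v m, \<tau> (N m))) (w, t) sequentially"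
      using lt lv by (simp add: limitin_pairwise o_def)
    have ran: "range (\<lambda>m. (v m, \<tau> (N m))) \<subseteq> topspace (prod_topology (top_of_set W) X3)"
      using Nv(2) \<tau>(2) by auto
    have "\<forall>\<^sub>F m in sequentially. good (v m, \<tau> (N m))"
      using SUF[unfolded semi_uniform_Feller_iff[OF K], rule_format, OF ran lim f e] by (simp add: good_def)
    then show False using Nv(4) by simp
  qed
  then show ?thesis by (simp only: good_def)
qed

text \<open>The integral over the slice at (\<open>z n\<close>, \<open>\<tau> n\<close>) is the
  integral of \<open>\<phi> (\<tau> n) B\<close> against \<open>z n\<close>, so measure and
  integrand vary together. The equicontinuous family is indexed by the Borel sets \<open>B\<close>
  and bounded by a bound of \<open>f\<close>.\<close>

lemma joint_kernel_semi_uniform: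
  fixes W :: "'w::{metric_space, second_countable_topology} set"
  assumes P: "stochastic_kernel (prod_topology (top_of_set W) XY)
        (prod_topology (top_of_set W) (prod_topology XY XA)) P"
    and SUF: "semi_uniform_Feller (top_of_set W) XY (prod_topology (top_of_set W) (prod_topology XY XA)) P"
    and z: "limitin (weak_topology (top_of_set W)) z z0 sequentially" "range z \<subseteq> prob_measures (top_of_set W)"
    and \<tau>: "limitin (prod_topology XY XA) \<tau> t sequentially" "range \<tau> \<subseteq> topspace (prod_topology XY XA)"
    and f: "f \<in> bounded_cont (top_of_set W)" and e: "0 < e"
  shows "\<forall>\<^sub>F n in sequentially. \<forall>B \<in> sets (borel_of XY).
    \<bar>(\<integral>x. f x \<partial>(fst_slice (top_of_set W) (joint_kernel P (z n, \<tau> n)) B)) -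
     (\<integral>x. f x \<partial>(fst_slice (top_of_set W) (joint_kernel P (z0, t)) B))\<bar> \<le> e"
proof -
  let ?XW = "top_of_set W"
  define \<phi> where "\<phi> s B w = (\<integral>x. f x \<partial>(fst_slice ?XW (P (w, s)) B))" for s B w
  obtain C where C: "0 < C" "\<And>x. x \<in> topspace ?XW \<Longrightarrow> \<bar>f x\<bar> \<le> C" using bounded_contE[OF f] by metis
  have z0: "z0 \<in> prob_measures ?XW" using z(1) by (simp add: limitin_def)
  have zn: "z n \<in> prob_measures ?XW" for n using z(2) by auto
  have t: "t \<in> topspace (prod_topology XY XA)" using \<tau>(1) by (simp add: limitin_def)
  have \<tau>n: "\<tau> n \<in> topspace (prod_topology XY XA)" for n using \<tau>(2) by auto
  have K: "P \<in> topspace (prod_topology ?XW (prod_topology XY XA)) \<rightarrow> prob_measures (prod_topology ?XW XY)"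
    using P unfolding stochastic_kernel_def by blast
  have joint: "(\<integral>x. f x \<partial>(fst_slice ?XW (joint_kernel P (\<zeta>, s)) B)) = (\<integral>w. \<phi> s B w \<partial>\<zeta>)"
    if "\<zeta> \<in> prob_measures ?XW" "s \<in> topspace (prod_topology XY XA)" "B \<in> sets (borel_of XY)" for \<zeta> s B
    using that integral_fst_slice_joint_kernel[OF P that(1) _ _ that(3) f, of "fst s" "snd s"]
    by (simp add: \<phi>_def mem_Times_iff)
  have \<phi>_meas: "\<phi> s B \<in> borel_measurable (borel_of ?XW)"
    if s: "s \<in> topspace (prod_topology XY XA)" and B: "B \<in> sets (borel_of XY)" for s B
  proof -
    have "(\<lambda>w. P (w, s)) \<in> borel_of ?XW \<rightarrow>\<^sub>M prob_algebra (borel_of (prod_topology ?XW XY))"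
      using kernel_section_measurable[OF P, of "fst s" "snd s"] s by (simp add: mem_Times_iff)
    from measurable_compose[OF fst_slice_kernel_measurable[OF this B]
        integral_measurable_subprob_algebra[OF borel_measurable_bounded_cont[OF f]]]
    show ?thesis by (simp add: \<phi>_def[abs_def])
  qed
  have \<phi>_bd: "\<bar>\<phi> s B w\<bar> \<le> C"
    if "s \<in> topspace (prod_topology XY XA)" "B \<in> sets (borel_of XY)" "w \<in> W" for s B w
    unfolding \<phi>_def using that C
    by (intro abs_integral_fst_slice_le[OF funcset_mem[OF K] that(2) borel_measurable_bounded_cont[OF f]]) auto
  have "\<forall>\<^sub>F n in sequentially. \<forall>B \<in> sets (borel_of XY). \<bar>(\<integral>w. \<phi> (\<tau> n) B w \<partial>z n) - (\<integral>w. \<phi> t B w \<partial>z0)\<bar> \<le> e"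
  proof (rule weak_convergence_equicontinuous_family[OF z0 zn z(1) _ _ _ _ _ _ C(1) e])
    fix w and e :: real assume w: "w \<in> W" and e: "0 < e"
    show "\<exists>r>0. \<forall>\<^sub>F n in sequentially. \<forall>v \<in> W \<inter> ball w r. \<forall>B \<in> sets (borel_of XY). \<bar>\<phi> (\<tau> n) B v - \<phi> t B w\<bar> \<le> e"
      unfolding \<phi>_def by (rule semi_uniform_Feller_equicontinuous[OF K SUF f \<tau> w e])
    \<comment> \<open>Equicontinuity of the limit functions \<open>\<phi> t B\<close> is the same
      lemma along the constant sequence \<open>t\<close>, where the eventual quantifier is
      vacuous.\<close>
    have "limitin (prod_topology XY XA) (\<lambda>_. t) t sequentially" "range (\<lambda>_. t) \<subseteq> topspace (prod_topology XY XA)"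
      using t by (auto simp: limitin_const_iff)
    from semi_uniform_Feller_equicontinuous[OF K SUF f this w e]
    show "\<exists>r>0. \<forall>v \<in> W \<inter> ball w r. \<forall>B \<in> sets (borel_of XY). \<bar>\<phi> t B v - \<phi> t B w\<bar> \<le> e"
      by (simp add: \<phi>_def)
  qed (use \<phi>_meas \<phi>_bd t \<tau>n in auto)
  then show ?thesis
    by eventually_elim (intro ballI, simp only: joint[OF zn \<tau>n] joint[OF z0 t])
qed

theorem theorem4p2:
  fixes W :: "'w::polish_space set"
    and Y :: "'y::polish_space set"
    and A :: "'a::polish_space set"
    and P :: "'w \<times> 'y \<times> 'a \<Rightarrow> ('w \<times> 'y) measure"
    and c :: "'w \<times> 'y \<times> 'a \<Rightarrow> ennreal"
    and q :: "'w measure \<times> 'y \<times> 'a \<Rightarrow> ('w measure \<times> 'y) measure"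
    and cbar :: "'w measure \<times> 'y \<times> 'a \<Rightarrow> ennreal"
  assumes "MDPII W Y A P c"
    and "MDPCI W Y A P c q cbar"
  shows "semi_uniform_Feller (weak_topology (top_of_set W)) (top_of_set Y)
           (prod_topology (weak_topology (top_of_set W))
             (prod_topology (top_of_set Y) (top_of_set A))) q
     \<longleftrightarrow> semi_uniform_Feller (top_of_set W) (top_of_set Y)
           (prod_topology (top_of_set W)
             (prod_topology (top_of_set Y) (top_of_set A))) P"
proof -
  let ?W = "top_of_set W" and ?Y = "top_of_set Y" and ?A = "top_of_set A"
  let ?Z = "weak_topology ?W"
  let ?YA = "prod_topology ?Y ?A"
  have P: "stochastic_kernel (prod_topology ?W ?Y) (prod_topology ?W ?YA) P"
    using assms(1) by (simp add: MDPII_def)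
  have q: "stochastic_kernel (prod_topology ?Z ?Y) (prod_topology ?Z ?YA) q"
    using assms(2) by (simp add: MDPCI_def)
  obtain H where H: "filter_kernel W Y A P H" and push: "\<And>z y a D C. z \<in> prob_measures ?W \<Longrightarrow> y \<in> Y \<Longrightarrow> a \<in> A \<Longrightarrow>
      D \<in> sets (borel_of ?Z) \<Longrightarrow> C \<in> sets (borel_of ?Y) \<Longrightarrow>
      emeasure (q (z, y, a)) (D \<times> C) =
        (\<integral>\<^sup>+y'\<in>C. indicator D (H (z, y, a, y')) \<partial>(snd_marginal ?W ?Y (joint_kernel P (z, y, a))))"
    using assms(2) unfolding MDPCI_def by blast
  have Pk: "P \<in> topspace (prod_topology ?W ?YA) \<rightarrow> prob_measures (prod_topology ?W ?Y)"
    using P unfolding stochastic_kernel_def by blast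
  have qk: "q \<in> topspace (prod_topology ?Z ?YA) \<rightarrow> prob_measures (prod_topology ?Z ?Y)"
    using q unfolding stochastic_kernel_def by blast
  define \<mu> where "\<mu> s = snd_marginal ?W ?Y (joint_kernel P s)" for s
  define h where "h s y' = H (fst s, fst (snd s), snd (snd s), y')" for s y'
  have R: "joint_kernel P s \<in> prob_measures (prod_topology ?W ?Y)" if "s \<in> topspace (prod_topology ?Z ?YA)" for s
    using joint_kernel_prob_measures[OF P, of "fst s" "fst (snd s)" "snd (snd s)"] that by (auto simp: mem_Times_iff)
  have \<mu>: "\<mu> s \<in> prob_measures ?Y" if "s \<in> topspace (prod_topology ?Z ?YA)" for s
    unfolding \<mu>_def by (rule snd_marginal_prob_measures[OF R[OF that]])
  have h: "h s \<in> borel_of ?Y \<rightarrow>\<^sub>M prob_algebra (borel_of ?W)" if s: "s \<in> topspace (prod_topology ?Z ?YA)" for s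
  proof -
    have "H \<in> borel_of (prod_topology ?Z (prod_topology ?Y (prod_topology ?A ?Y))) \<rightarrow>\<^sub>M prob_algebra (borel_of ?W)"
      using H by (simp add: filter_kernel_def stochastic_kernel_iff)
    moreover have "(\<lambda>y'. (fst s, fst (snd s), snd (snd s), y')) \<in>
        borel_of ?Y \<rightarrow>\<^sub>M borel_of (prod_topology ?Z (prod_topology ?Y (prod_topology ?A ?Y)))"
      using s by (intro borel_of_measurable_continuous continuous_map_pairedI) (auto simp: mem_Times_iff)
    ultimately show ?thesis unfolding h_def[abs_def] by (rule measurable_compose[rotated])
  qed
  \<comment> \<open>Together with \<open>slice_q\<close> this expresses slices of the joint kernel
    and of \<open>q\<close> through the same pair \<open>\<mu> s\<close>, \<open>h s\<close>; the
    former are the latter for the functions \<nu> \<mapsto> \<integral>f d\<nu>.\<close>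
  have slice_R: "(\<integral>x. f x \<partial>(fst_slice ?W (joint_kernel P s) B)) = (\<integral>y. indicator B y * (\<integral>x. f x \<partial>h s y) \<partial>\<mu> s)"
    if s: "s \<in> topspace (prod_topology ?Z ?YA)" and B: "B \<in> sets (borel_of ?Y)" and f: "f \<in> bounded_cont ?W" for s B f
  proof (rule integral_fst_slice_disintegration[OF R[OF s] \<mu>[OF s] h[OF s] B _ f])
    fix E assume "E \<in> sets (borel_of ?W)"
    then show "emeasure (joint_kernel P s) (E \<times> B) = (\<integral>\<^sup>+y\<in>B. emeasure (h s y) E \<partial>\<mu> s)"
      using H s B unfolding filter_kernel_def by (cases s) (auto simp: h_def \<mu>_def)
  qed
  have slice_q: "(\<integral>x. F x \<partial>(fst_slice ?Z (q s) B)) = (\<integral>y. indicator B y * F (h s y) \<partial>\<mu> s)"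
    if s: "s \<in> topspace (prod_topology ?Z ?YA)" and B: "B \<in> sets (borel_of ?Y)" and F: "F \<in> bounded_cont ?Z" for s B F
  proof (rule integral_fst_slice_pushforward[OF funcset_mem[OF qk s] \<mu>[OF s] measurable_borel_of_weak_topology[OF h[OF s]] B _ F])
    fix D assume "D \<in> sets (borel_of ?Z)"
    then show "emeasure (q s) (D \<times> B) = (\<integral>\<^sup>+y\<in>B. indicator D (h s y) \<partial>\<mu> s)"
      using push[OF _ _ _ _ B] s by (cases s) (auto simp: h_def \<mu>_def)
  qed
  show ?thesis
  proof
    assume SUF: "semi_uniform_Feller ?Z ?Y (prod_topology ?Z ?YA) q"
    show "semi_uniform_Feller ?W ?Y (prod_topology ?W ?YA) P"
      unfolding semi_uniform_Feller_iff[OF Pk]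
    proof (intro allI impI)
      fix \<sigma> s f and e :: real
      assume \<sigma>: "range \<sigma> \<subseteq> topspace (prod_topology ?W ?YA)" "limitin (prod_topology ?W ?YA) \<sigma> s sequentially"
        and f: "f \<in> bounded_cont ?W" and e: "0 < e"
      \<comment> \<open>This embedding by Dirac measures is sequentially continuous, and the joint
        kernel composed with it is \<open>P\<close>; so the property of \<open>q\<close> at the
        points \<open>\<delta> p\<close> is a statement about \<open>P\<close>.\<close>
      define \<delta> where "\<delta> p = (return (borel_of ?W) (fst p), snd p)" for p :: "'w \<times> 'y \<times> 'a"
      have \<delta>: "\<delta> p \<in> topspace (prod_topology ?Z ?YA)" if "p \<in> topspace (prod_topology ?W ?YA)" for p
        using that by (auto simp: \<delta>_def intro!: return_in_prob_measures)
      have slice: "(\<integral>\<nu>. (\<integral>x. f x \<partial>\<nu>) \<partial>(fst_slice ?Z (q (\<delta> p)) B)) = (\<integral>x. f x \<partial>(fst_slice ?W (P p) B))"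
        if p: "p \<in> topspace (prod_topology ?W ?YA)" and B: "B \<in> sets (borel_of ?Y)" for p B
      proof -
        have "joint_kernel P (\<delta> p) = P p"
          using joint_kernel_return[OF P, of "fst p" "fst (snd p)" "snd (snd p)"] p by (auto simp: \<delta>_def mem_Times_iff)
        then show ?thesis
          using slice_q[OF \<delta>[OF p] B integral_bounded_cont_weak_topology[OF f]] slice_R[OF \<delta>[OF p] B f] by simp
      qed
      have \<sigma>n: "\<sigma> n \<in> topspace (prod_topology ?W ?YA)" for n using \<sigma>(1) by auto
      have s: "s \<in> topspace (prod_topology ?W ?YA)" using \<sigma>(2) by (simp add: limitin_def)
      have ran: "range (\<lambda>n. \<delta> (\<sigma> n)) \<subseteq> topspace (prod_topology ?Z ?YA)" using \<delta>[OF \<sigma>n] by blast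
      have lW: "limitin ?W (fst \<circ> \<sigma>) (fst s) sequentially" and lYA: "limitin ?YA (snd \<circ> \<sigma>) (snd s) sequentially"
        using \<sigma>(2) unfolding limitin_pairwise by auto
      have "range (fst \<circ> \<sigma>) \<subseteq> topspace ?W" using \<sigma>n by (auto simp: mem_Times_iff)
      from limitin_return[OF lW this] lYA
      have lim: "limitin (prod_topology ?Z ?YA) (\<lambda>n. \<delta> (\<sigma> n)) (\<delta> s) sequentially"
        unfolding limitin_pairwise by (simp add: \<delta>_def o_def)
      from SUF[unfolded semi_uniform_Feller_iff[OF qk], rule_format, OF ran lim integral_bounded_cont_weak_topology[OF f] e]
      show "\<forall>\<^sub>F n in sequentially. \<forall>B \<in> sets (borel_of ?Y).
        \<bar>(\<integral>x. f x \<partial>(fst_slice ?W (P (\<sigma> n)) B)) - (\<integral>x. f x \<partial>(fst_slice ?W (P s) B))\<bar> \<le> e"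
        by eventually_elim (auto simp: slice[OF \<sigma>n] slice[OF s])
    qed
  next
    assume SUF: "semi_uniform_Feller ?W ?Y (prod_topology ?W ?YA) P"
    show "semi_uniform_Feller ?Z ?Y (prod_topology ?Z ?YA) q"
      unfolding semi_uniform_Feller_iff[OF qk]
    proof (intro allI impI)
      fix \<sigma> s F and e :: real
      assume \<sigma>: "range \<sigma> \<subseteq> topspace (prod_topology ?Z ?YA)" "limitin (prod_topology ?Z ?YA) \<sigma> s sequentially"
        and F: "F \<in> bounded_cont ?Z" and e: "0 < e"
      have \<sigma>n: "\<sigma> n \<in> topspace (prod_topology ?Z ?YA)" for n using \<sigma>(1) by auto
      have s: "s \<in> topspace (prod_topology ?Z ?YA)" using \<sigma>(2) by (simp add: limitin_def)
      have "\<forall>\<^sub>F n in sequentially. \<forall>B \<in> sets (borel_of ?Y).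
        \<bar>(\<integral>y. indicator B y * F (h (\<sigma> n) y) \<partial>\<mu> (\<sigma> n)) - (\<integral>y. indicator B y * F (h s y) \<partial>\<mu> s)\<bar> \<le> e"
      proof (rule filter_semi_uniform_convergence[OF \<mu>[OF \<sigma>n] \<mu>[OF s] h[OF \<sigma>n] h[OF s] _ F e])
        fix f and e :: real assume f: "f \<in> bounded_cont ?W" and e: "0 < e"
        have lim: "limitin ?Z (fst \<circ> \<sigma>) (fst s) sequentially" "limitin ?YA (snd \<circ> \<sigma>) (snd s) sequentially"
          using \<sigma>(2) unfolding limitin_pairwise by auto
        have ran: "range (fst \<circ> \<sigma>) \<subseteq> prob_measures ?W" "range (snd \<circ> \<sigma>) \<subseteq> topspace ?YA"
        proof -
          have "fst (\<sigma> n) \<in> prob_measures ?W" "snd (\<sigma> n) \<in> topspace ?YA" for n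
            using \<sigma>n[of n] unfolding topspace_prod_topology[of ?Z] topspace_weak_topology mem_Times_iff by blast+
          then show "range (fst \<circ> \<sigma>) \<subseteq> prob_measures ?W" "range (snd \<circ> \<sigma>) \<subseteq> topspace ?YA"
            by (intro image_subsetI; simp only: o_apply)+
        qed
        from joint_kernel_semi_uniform[OF P SUF lim(1) ran(1) lim(2) ran(2) f e]
        show "\<forall>\<^sub>F n in sequentially. \<forall>B \<in> sets (borel_of ?Y).
          \<bar>(\<integral>y. indicator B y * (\<integral>x. f x \<partial>h (\<sigma> n) y) \<partial>\<mu> (\<sigma> n)) - (\<integral>y. indicator B y * (\<integral>x. f x \<partial>h s y) \<partial>\<mu> s)\<bar> \<le> e"
          by eventually_elim (auto simp: slice_R[OF \<sigma>n _ f] slice_R[OF s _ f])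
      qed
      then show "\<forall>\<^sub>F n in sequentially. \<forall>B \<in> sets (borel_of ?Y).
        \<bar>(\<integral>x. F x \<partial>(fst_slice ?Z (q (\<sigma> n)) B)) - (\<integral>x. F x \<partial>(fst_slice ?Z (q s) B))\<bar> \<le> e"
        by eventually_elim (auto simp: slice_q[OF \<sigma>n _ F] slice_q[OF s _ F])
    qed
  qed
qed

end
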